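(* Let $\mu_1,\mu_2,c>0$, let $g(\pi)=\pi_1\wedge(1-\pi_1)\wedge\pi_2\wedge(1-\pi_2)$ for $\pi=(\pi_1,\pi_2)\in[0,1]^2$, let $$V(\pi)=\inf_\tau\mathbb E_\pi\left[g(\Pi_\tau)+c\tau\right],$$ let $\mathcal D=\{\pi\in[0,1]^2:V(\pi)=g(\pi)\}$ be the stopping region, and let $T=\{\pi\in[0,1]^2:\pi_2\le\pi_1\wedge(1-\pi_1)\}$. Then there exists an upper semi-continuous function $b:[0,1]\to[0,1]$ with $b(\pi_1)\le\pi_1\wedge(1-\pi_1)$ for all $\pi_1\in[0,1]$ such that $$\mathcal D\cap T=\{\pi\in T:\pi_2\le b(\pi_1)\}.$$ Furthermore, $b$ is non-decreasing on $[0,1/2]$ and satisfies $b(\pi_1)=b(1-\pi_1)$.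
   Context: Set-up (two-dimensional sequential testing). For $\pi\in[0,1]^2$, under $\mathbb P_\pi$ (expectation $\mathbb E_\pi$) the random variables $Y^1,Y^2$ take values in $\{0,1\}$ with $\mathbb P_\pi(Y^i=1)=\pi_i$, $W^1,W^2$ are standard Brownian motions, and $Y^1,Y^2,W^1,W^2$ are independent. One observes $X=(X^1,X^2)$ with $X^i_t=\mu_iY^it+W^i_t$, and $\mathcal F^X$ is the filtration generated by $X$. The posterior process $\Pi=(\Pi^1,\Pi^2)$ is $\Pi^i_t=\mathbb E_\pi[Y^i\mid\mathcal F^X_t]$ (continuous version); it satisfies $\Pi_0=\pi$ and $d\Pi^i_t=\mu_i\Pi^i_t(1-\Pi^i_t)\,d\bar W^i_t$, where $\bar W^i_t=X^i_t-\mu_i\int_0^t\Pi^i_s\,ds$ and $(\bar W^1,\bar W^2)$ is a two-dimensional standard Brownian motion. The infimum in $V$ is over ($\mathbb P_\pi$-a.s. finite) $\mathcal F^X$-stopping times. Since $V\le g$, the stopping region $\mathcal D$ is the complement in $[0,1]^2$ of the continuation region $\mathcal C=\{V<g\}$. *)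

theory Defs
  imports "HOL-Probability.Probability"
begin

text \<open>The sigma-algebra on the sample space of \<open>M\<close> generated by the real random variables
  \<open>Z j\<close>, \<open>j \<in> J\<close>.\<close>

definition generated_sigma :: "'a measure \<Rightarrow> ('j \<Rightarrow> 'a \<Rightarrow> real) \<Rightarrow> 'j set \<Rightarrow> 'a measure" where
  "generated_sigma M Z J =
     sigma (space M) (\<Union>j\<in>J. {Z j -` A \<inter> space M | A. A \<in> sets borel})"

text \<open>Only times \<open>t \<ge> 0\<close> are meaningful; the values at negative times are never used.\<close>

definition brownian_motion :: "'a measure \<Rightarrow> (real \<Rightarrow> 'a \<Rightarrow> real) \<Rightarrow> bool" where
  "brownian_motion N B \<longleftrightarrow>
     (\<forall>t\<ge>0. B t \<in> borel_measurable N) \<and>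
     (AE \<omega> in N. B 0 \<omega> = 0) \<and>
     (AE \<omega> in N. continuous_on {0..} (\<lambda>t. B t \<omega>)) \<and>
     (\<forall>s t. 0 \<le> s \<and> s < t \<longrightarrow>
        distributed N lborel (\<lambda>\<omega>. B t \<omega> - B s \<omega>) (normal_density 0 (sqrt (t - s)))) \<and>
     (\<forall>(t :: nat \<Rightarrow> real) n. 0 \<le> t 0 \<and> mono t \<longrightarrow>
        prob_space.indep_vars N (\<lambda>_. borel) (\<lambda>k \<omega>. B (t (Suc k)) \<omega> - B (t k) \<omega>) {..<n})"

text \<open>\<open>M\<close> only carries the measurable space on which all the laws \<open>P \<pi>\<close> and the random variables
  live; its measure is irrelevant. In the last clause \<open>Inl i\<close> indexes \<open>Y i\<close> and \<open>Inr i\<close> the whole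
  path of \<open>W i\<close>, so that it states the joint independence of the four objects
  \<open>Y 1, Y 2, W 1, W 2\<close>.\<close>

definition testing_model ::
  "'a measure \<Rightarrow> (real^2 \<Rightarrow> 'a measure) \<Rightarrow> (2 \<Rightarrow> 'a \<Rightarrow> real) \<Rightarrow> (2 \<Rightarrow> real \<Rightarrow> 'a \<Rightarrow> real) \<Rightarrow> bool"
where
  "testing_model M P Y W \<longleftrightarrow>
     (\<forall>i. Y i \<in> borel_measurable M \<and> (\<forall>\<omega>\<in>space M. Y i \<omega> \<in> {0, 1})) \<and>
     (\<forall>i. \<forall>t\<ge>0. W i t \<in> borel_measurable M) \<and>
     (\<forall>\<pi>\<in>cbox 0 1.
        prob_space (P \<pi>) \<and> sets (P \<pi>) = sets M \<and>
        (\<forall>i. measure (P \<pi>) {\<omega> \<in> space M. Y i \<omega> = 1} = \<pi> $ i) \<and>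
        (\<forall>i. brownian_motion (P \<pi>) (W i)) \<and>
        prob_space.indep_sets (P \<pi>)
          (case_sum (\<lambda>i. sets (generated_sigma M Y {i}))
                    (\<lambda>i. sets (generated_sigma M (W i) {0..})))
          (UNIV :: (2 + 2) set))"

definition observation ::
  "real^2 \<Rightarrow> (2 \<Rightarrow> 'a \<Rightarrow> real) \<Rightarrow> (2 \<Rightarrow> real \<Rightarrow> 'a \<Rightarrow> real) \<Rightarrow> 2 \<Rightarrow> real \<Rightarrow> 'a \<Rightarrow> real"
where
  "observation \<mu> Y W i t \<omega> = \<mu> $ i * Y i \<omega> * t + W i t \<omega>"

text \<open>The filtration generated by a two-dimensional process \<open>X\<close>, indexed by
  \<open>[0,\<infinity>]\<close> so that stopping times may take the value \<open>\<infinity>\<close>; at \<open>\<infinity>\<close> it is the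
  sigma-algebra generated by the whole path.\<close>

definition observed_filtration ::
  "'a measure \<Rightarrow> (2 \<Rightarrow> real \<Rightarrow> 'a \<Rightarrow> real) \<Rightarrow> ennreal \<Rightarrow> 'a measure"
where
  "observed_filtration M X t =
     generated_sigma M (\<lambda>(i, s). X i s) (UNIV \<times> {s. 0 \<le> s \<and> ennreal s \<le> t})"

text \<open>\<open>Q\<close> is a continuous version, under the law \<open>N\<close>, of the process of conditional
  expectations of \<open>Y i\<close> given the filtration \<open>F\<close>.\<close>

definition posterior_process ::
  "'a measure \<Rightarrow> (ennreal \<Rightarrow> 'a measure) \<Rightarrow> (2 \<Rightarrow> 'a \<Rightarrow> real) \<Rightarrow> (2 \<Rightarrow> real \<Rightarrow> 'a \<Rightarrow> real) \<Rightarrow> bool"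
where
  "posterior_process N F Y Q \<longleftrightarrow>
     (\<forall>i. (\<forall>t\<ge>0. Q i t \<in> borel_measurable (F (ennreal t)) \<and>
              (AE \<omega> in N. Q i t \<omega> = real_cond_exp N (F (ennreal t)) (Y i) \<omega>)) \<and>
          (AE \<omega> in N. continuous_on {0..} (\<lambda>t. Q i t \<omega>)))"

definition terminal_cost :: "real^2 \<Rightarrow> real" where
  "terminal_cost \<pi> = min (min (\<pi> $ 1) (1 - \<pi> $ 1)) (min (\<pi> $ 2) (1 - \<pi> $ 2))"

text \<open>The expected cost may be infinite, hence the extended nonnegative values. The integrand is
  almost surely nonnegative, since the posterior process almost surely stays in \<open>[0,1]\<^sup>2\<close>, and its
  value on the null set where \<open>\<tau> = \<infinity>\<close> plays no role.\<close>

definition value_function ::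
  "(real^2 \<Rightarrow> 'a measure) \<Rightarrow> (ennreal \<Rightarrow> 'a measure) \<Rightarrow> (real^2 \<Rightarrow> 2 \<Rightarrow> real \<Rightarrow> 'a \<Rightarrow> real) \<Rightarrow>
   real \<Rightarrow> real^2 \<Rightarrow> ennreal"
where
  "value_function P F Q c \<pi> =
     (INF \<tau> \<in> {\<tau>. stopping_time F \<tau> \<and> (AE \<omega> in P \<pi>. \<tau> \<omega> < \<infinity>)}.
        \<integral>\<^sup>+ \<omega>. ennreal (terminal_cost (\<chi> i. Q \<pi> i (enn2real (\<tau> \<omega>)) \<omega>)) + ennreal c * \<tau> \<omega> \<partial>P \<pi>)"

definition stopping_region :: "(real^2 \<Rightarrow> ennreal) \<Rightarrow> (real^2) set" where
  "stopping_region V = {\<pi> \<in> cbox 0 1. V \<pi> = ennreal (terminal_cost \<pi>)}"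

definition bottom_triangle :: "(real^2) set" where
  "bottom_triangle = {\<pi> \<in> cbox 0 1. \<pi> $ 2 \<le> min (\<pi> $ 1) (1 - \<pi> $ 1)}"

definition upper_semicontinuous_on :: "'b::topological_space set \<Rightarrow> ('b \<Rightarrow> real) \<Rightarrow> bool" where
  "upper_semicontinuous_on S f \<longleftrightarrow>
     (\<forall>x\<in>S. \<forall>a. f x < a \<longrightarrow> (\<forall>\<^sub>F y in at x within S. f y < a))"

end

theory Submission
  imports Defs
begin

text \<open>The value function is an infimum of expected costs that are affine in each coordinate of the
  prior. Rounding a stopping time up to a dyadic grid and taking the best of the four terminal
  decisions at the rounded time turns \<open>E[g(\<Pi>\<^sub>\<tau>) + c \<tau>]\<close> into a sum of probabilities of events of
  \<open>(Y, W)\<close>, up to an error that vanishes as the grid is refined, by continuity of the posterior. The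
  law of \<open>(Y, W)\<close> is affine in each \<open>\<pi>\<^sub>i\<close>, since the law of the Brownian motions does not depend on
  \<open>\<pi>\<close>. Hence \<open>V\<close> is concave in each coordinate. The reflection \<open>(Y\<^sub>1, W\<^sub>1) \<mapsto> (1 - Y\<^sub>1, - W\<^sub>1)\<close> sends
  the observation \<open>X\<^sub>1(t)\<close> to \<open>\<mu>\<^sub>1 t - X\<^sub>1(t)\<close>, so \<open>V\<close> is symmetric under \<open>\<pi>\<^sub>1 \<mapsto> 1 - \<pi>\<^sub>1\<close>. Together
  with \<open>0 \<le> V \<le> g\<close>, concavity makes \<open>V\<close> 1-Lipschitz in each coordinate. On \<open>T\<close> we have \<open>g = \<pi>\<^sub>2\<close>;
  concavity in \<open>\<pi>\<^sub>2\<close> makes the vertical sections of \<open>D\<close> intervals starting at 0, and concavity and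
  symmetry in \<open>\<pi>\<^sub>1\<close> make its horizontal sections symmetric intervals around 1/2.\<close>

section \<open>Finite-dimensional laws of Brownian motion\<close>

text \<open>After sorting \<open>S\<close>, the path values are partial sums of increments.
  Independence and the normal laws of the increments turn both sides into the measure of one set
  \<open>E\<close> under one product measure that depends only on the times.\<close>

lemma brownian_motion_cylinder_eq:
  assumes N: "prob_space N" and N': "prob_space N'"
    and B: "brownian_motion N B" and B': "brownian_motion N' B'"
    and S: "finite S" "S \<subseteq> {0..}" and A: "\<And>t. t \<in> S \<Longrightarrow> A t \<in> sets borel"
  shows "measure N {\<omega> \<in> space N. \<forall>t\<in>S. B t \<omega> \<in> A t}
       = measure N' {\<omega> \<in> space N'. \<forall>t\<in>S. B' t \<omega> \<in> A t}"
proof -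
  define xs where "xs = sorted_list_of_set S"
  define n where "n = length xs"
  \<comment> \<open>\<open>t\<close> lists 0 and then the sorted times, and is frozen at the last
    one from index \<open>n\<close> on, because \<open>brownian_motion\<close> speaks of monotone
    sequences on all of \<open>nat\<close>.\<close>
  define t where "t k = (0 # xs) ! min k n" for k
  have sorted: "sorted (0 # xs)"
    using S by (auto simp: xs_def)
  have t0: "t 0 = 0" by (simp add: t_def)
  have mono: "mono t"
    unfolding t_def by (intro monoI sorted_nth_mono[OF sorted]) (auto simp: n_def)
  have tnn: "t k \<ge> 0" for k using monoD[OF mono, of 0 k] t0 by simp
  have S_eq: "S = (\<lambda>k. t (Suc k)) ` {..<n}"
  proof -
    have "S = set xs" using S by (simp add: xs_def)
    also have "\<dots> = (\<lambda>k. xs ! k) ` {..<n}" by (auto simp: n_def set_conv_nth)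
    also have "\<dots> = (\<lambda>k. t (Suc k)) ` {..<n}" by (intro image_cong) (auto simp: t_def min_def)
    finally show ?thesis .
  qed
  define E where "E = {d \<in> space (PiM {..<n} (\<lambda>_. borel :: real measure)).
      \<forall>k\<in>{..<n}. (\<Sum>j<Suc k. d j) \<in> A (t (Suc k))}"
  have E: "E \<in> sets (PiM {..<n} (\<lambda>_. borel))"
    unfolding E_def
  proof (intro sets.sets_Collect_finite_All)
    fix k assume k: "k \<in> {..<n}"
    have [measurable]: "A (t (Suc k)) \<in> sets borel" using A S_eq k by auto
    have [measurable]: "(\<lambda>d. \<Sum>j<Suc k. d j) \<in> borel_measurable (PiM {..<n} (\<lambda>_. borel :: real measure))"
      using k by (intro borel_measurable_sum measurable_component_singleton) auto
    show "{d \<in> space (PiM {..<n} (\<lambda>_. borel :: real measure)). (\<Sum>j<Suc k. d j) \<in> A (t (Suc k))}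
        \<in> sets (PiM {..<n} (\<lambda>_. borel))"
      by measurable
  qed simp
  have main: "measure N {\<omega> \<in> space N. \<forall>t\<in>S. B t \<omega> \<in> A t}
     = measure (PiM {..<n} (\<lambda>k. distr N borel (\<lambda>\<omega>. B (t (Suc k)) \<omega> - B (t k) \<omega>))) E"
    if "prob_space N" "brownian_motion N B" "n \<noteq> 0" for N :: "'d measure" and B
  proof -
    interpret prob_space N by fact
    have [measurable]: "B (t k) \<in> borel_measurable N" for k
      using that(2) tnn by (auto simp: brownian_motion_def)
    have ind: "indep_vars (\<lambda>_. borel) (\<lambda>k \<omega>. B (t (Suc k)) \<omega> - B (t k) \<omega>) {..<n}"
      using that(2) t0 mono by (auto simp: brownian_motion_def)
    let ?D = "\<lambda>\<omega>. \<lambda>k\<in>{..<n}. B (t (Suc k)) \<omega> - B (t k) \<omega>"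
    have D: "?D \<in> measurable N (PiM {..<n} (\<lambda>_. borel))" by measurable
    have *: "distr N (PiM {..<n} (\<lambda>_. borel)) ?D
      = PiM {..<n} (\<lambda>k. distr N borel (\<lambda>\<omega>. B (t (Suc k)) \<omega> - B (t k) \<omega>))"
      using ind that(3) by (subst (asm) indep_vars_iff_distr_eq_PiM) auto
    have sets1: "{\<omega> \<in> space N. \<forall>t\<in>S. B t \<omega> \<in> A t} \<in> sets N"
    proof (intro sets.sets_Collect_finite_All)
      fix s assume s: "s \<in> S"
      then obtain k where "s = t (Suc k)" using S_eq by auto
      then have [measurable]: "B s \<in> borel_measurable N" by simp
      show "{\<omega> \<in> space N. B s \<omega> \<in> A s} \<in> sets N"
        using A[OF s] by measurable
    qed (use S in simp)
    \<comment> \<open>The telescoping sum recovers \<open>B (t (Suc k))\<close> where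
      \<open>B 0\<close> vanishes, so the two events are only compared almost surely.\<close>
    have "AE \<omega> in N. B 0 \<omega> = 0" using that(2) by (simp add: brownian_motion_def)
    then have "AE \<omega> in N. \<omega> \<in> {\<omega> \<in> space N. \<forall>t\<in>S. B t \<omega> \<in> A t} \<longleftrightarrow> \<omega> \<in> ?D -` E \<inter> space N"
    proof eventually_elim
      case (elim \<omega>)
      have "(\<Sum>j<Suc k. ?D \<omega> j) = B (t (Suc k)) \<omega>" if "k < n" for k
      proof -
        have "(\<Sum>j<Suc k. ?D \<omega> j) = (\<Sum>j<Suc k. B (t (Suc j)) \<omega> - B (t j) \<omega>)"
          using that by (intro sum.cong) auto
        also have "\<dots> = B (t (Suc k)) \<omega>" by (subst sum_lessThan_telescope) (simp add: t0 elim)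
        finally show ?thesis .
      qed
      then show ?case by (auto simp: E_def S_eq space_PiM)
    qed
    then have "measure N {\<omega> \<in> space N. \<forall>t\<in>S. B t \<omega> \<in> A t} = measure N (?D -` E \<inter> space N)"
      using sets1 measurable_sets[OF D E] by (intro measure_eq_AE) auto
    also have "\<dots> = measure (distr N (PiM {..<n} (\<lambda>_. borel)) ?D) E"
      by (simp add: measure_distr[OF D E])
    finally show ?thesis by (simp add: *)
  qed
  \<comment> \<open>If \<open>0 \<in> S\<close>, the first increment is degenerate
    (\<open>t 1 = t 0\<close>). The density clause covers \<open>s < t\<close> only; here the law is
    the point mass at 0.\<close>
  have incr: "distr N borel (\<lambda>\<omega>. B (t (Suc k)) \<omega> - B (t k) \<omega>)
     = (if t k < t (Suc k) then density lborel (normal_density 0 (sqrt (t (Suc k) - t k))) else return borel 0)"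
    if "prob_space N" "brownian_motion N B" for N :: "'d measure" and B k
  proof (cases "t k < t (Suc k)")
    case True
    then have "distributed N lborel (\<lambda>\<omega>. B (t (Suc k)) \<omega> - B (t k) \<omega>) (normal_density 0 (sqrt (t (Suc k) - t k)))"
      using that(2) tnn by (simp add: brownian_motion_def)
    from distributed_distr_eq_density[OF this] True show ?thesis
      by (simp cong: distr_cong)
  next
    case False
    then have "t (Suc k) = t k" using monoD[OF mono, of k "Suc k"] by simp
    then show ?thesis using False prob_space.distr_const[OF that(1), of 0 borel] by simp
  qed
  \<comment> \<open>\<open>main\<close> rests on the product form of independence, which asks for a
    nonempty index set; hence \<open>S = {}\<close> is treated separately.\<close>
  show ?thesis
  proof (cases "n = 0")
    case True
    then have "S = {}" using S_eq by simp
    then show ?thesis using prob_space.prob_space[OF N] prob_space.prob_space[OF N'] by simp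
  next
    case False
    show ?thesis
      unfolding main[OF N B False] main[OF N' B' False] incr[OF N B] incr[OF N' B'] ..
  qed
qed

text \<open>The centred normal law is symmetric. This supplies the noise of the reflected
  problem.\<close>

lemma brownian_motion_uminus:
  assumes "prob_space N" "brownian_motion N B"
  shows "brownian_motion N (\<lambda>t \<omega>. - B t \<omega>)"
proof -
  interpret prob_space N by fact
  note b = assms(2)[unfolded brownian_motion_def]
  have 1: "distributed N lborel (\<lambda>\<omega>. - B t \<omega> - - B s \<omega>) (normal_density 0 (sqrt (t - s)))"
    if "0 \<le> s" "s < t" for s t
  proof -
    have "distributed N lborel (\<lambda>\<omega>. B t \<omega> - B s \<omega>) (normal_density 0 (sqrt (t - s)))"
      using b that by blast
    from normal_density_affine[OF this, of "-1" 0] show ?thesis using that by simp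
  qed
  have 2: "indep_vars (\<lambda>_. borel) (\<lambda>k \<omega>. - B (t (Suc k)) \<omega> - - B (t k) \<omega>) {..<n}"
    if "0 \<le> t 0 \<and> mono t" for t :: "nat \<Rightarrow> real" and n
  proof -
    have "indep_vars (\<lambda>_. borel) (\<lambda>k \<omega>. B (t (Suc k)) \<omega> - B (t k) \<omega>) {..<n}"
      using b that by blast
    then have "indep_vars (\<lambda>_. borel) (\<lambda>k \<omega>. - (B (t (Suc k)) \<omega> - B (t k) \<omega>)) {..<n}"
      by (rule indep_vars_compose2[where Y = "\<lambda>_ x. - x"]) auto
    then show ?thesis by simp
  qed
  have 3: "AE \<omega> in N. continuous_on {0..} (\<lambda>t. - B t \<omega>)"
    using b by (auto intro: continuous_intros elim: eventually_mono)
  show ?thesis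
    unfolding brownian_motion_def using b 1 2 3 by auto
qed

section \<open>The joint law of the hypotheses and the noise\<close>

lemma generated_sigma_subset_Pow:
  "(\<Union>j\<in>J. {Z j -` A \<inter> space M | A. A \<in> sets borel}) \<subseteq> Pow (space M)"
  by auto

lemma space_generated_sigma [simp]: "space (generated_sigma M Z J) = space M"
  unfolding generated_sigma_def by (rule space_measure_of[OF generated_sigma_subset_Pow])

lemma sets_generated_sigma:
  "sets (generated_sigma M Z J)
     = sigma_sets (space M) (\<Union>j\<in>J. {Z j -` A \<inter> space M | A. A \<in> sets borel})"
  unfolding generated_sigma_def by (rule sets_measure_of[OF generated_sigma_subset_Pow])

lemma measurable_generated_sigma:
  "j \<in> J \<Longrightarrow> Z j \<in> borel_measurable (generated_sigma M Z J)"
  by (rule measurableI) (auto simp: sets_generated_sigma)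

lemma sets_generated_sigma_mono:
  "J \<subseteq> J' \<Longrightarrow> sets (generated_sigma M Z J) \<subseteq> sets (generated_sigma M Z J')"
  unfolding sets_generated_sigma by (rule sigma_sets_mono') auto

lemma sets_generated_sigma_subset:
  assumes "\<And>j. j \<in> J \<Longrightarrow> Z j \<in> borel_measurable N" "space N = space M"
  shows "sets (generated_sigma M Z J) \<subseteq> sets N"
  unfolding sets_generated_sigma assms(2)[symmetric]
  using assms(1) by (intro sets.sigma_sets_subset) (auto simp: measurable_sets)

section \<open>Comparison of laws on a product space\<close>

text \<open>Dynkin argument: finite-dimensional cylinders are an intersection-stable generator, and
  the affine identity survives complements because its weights sum to 1. With \<open>Q2 = Q3\<close>
  it becomes uniqueness of a law given its cylinder probabilities.\<close>

lemma PiM_prob_convex_eqI: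
  assumes Q: "prob_space Q1" "prob_space Q2" "prob_space Q3"
    and s: "sets Q1 = sets (PiM I M)" "sets Q2 = sets (PiM I M)" "sets Q3 = sets (PiM I M)"
    and eq: "\<And>J X. finite J \<Longrightarrow> J \<subseteq> I \<Longrightarrow> X \<in> (\<Pi> j\<in>J. sets (M j)) \<Longrightarrow>
       measure Q1 (prod_emb I M J (Pi\<^sub>E J X)) =
         l * measure Q2 (prod_emb I M J (Pi\<^sub>E J X)) + (1 - l) * measure Q3 (prod_emb I M J (Pi\<^sub>E J X))"
    and E: "E \<in> sets (PiM I M)"
  shows "measure Q1 E = l * measure Q2 E + (1 - l) * measure Q3 E"
proof -
  interpret Q1: prob_space Q1 by fact
  interpret Q2: prob_space Q2 by fact
  interpret Q3: prob_space Q3 by fact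
  have sp: "space Q1 = (\<Pi>\<^sub>E i\<in>I. space (M i))" "space Q2 = (\<Pi>\<^sub>E i\<in>I. space (M i))" "space Q3 = (\<Pi>\<^sub>E i\<in>I. space (M i))"
    using s[THEN sets_eq_imp_space_eq] by (auto simp: space_PiM)
  have ev: "A \<in> sets Q1" "A \<in> sets Q2" "A \<in> sets Q3"
    if "A \<in> sigma_sets (\<Pi>\<^sub>E i\<in>I. space (M i)) (prod_algebra I M)" for A
    using that by (auto simp: s sets_PiM)
  show ?thesis
    using E unfolding sets_PiM
  proof (induction rule: sigma_sets_induct_disjoint[OF Int_stable_prod_algebra prod_algebra_sets_into_space,
        consumes 1, case_names basic empty compl union])
    case (basic A)
    then obtain J X where "finite J" "J \<subseteq> I" "X \<in> (\<Pi> j\<in>J. sets (M j))" "A = prod_emb I M J (Pi\<^sub>E J X)"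
      unfolding prod_algebra_def by blast
    then show ?case using eq by simp
  next
    case empty
    then show ?case by simp
  next
    case (compl A)
    note c = Q1.prob_compl[OF ev(1)[OF compl(1)], unfolded sp] Q2.prob_compl[OF ev(2)[OF compl(1)], unfolded sp]
      Q3.prob_compl[OF ev(3)[OF compl(1)], unfolded sp]
    show ?case unfolding c compl.IH by (simp add: algebra_simps)
  next
    case (union A)
    have rng: "range A \<subseteq> sets Q1" "range A \<subseteq> sets Q2" "range A \<subseteq> sets Q3"
      using union(2) ev by blast+
    note u = Q1.finite_measure_UNION[OF rng(1) union(1)] Q2.finite_measure_UNION[OF rng(2) union(1)]
      Q3.finite_measure_UNION[OF rng(3) union(1)]
    from u(2,3) have "(\<lambda>i. l * measure Q2 (A i) + (1 - l) * measure Q3 (A i)) sums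
        (l * measure Q2 (\<Union>i. A i) + (1 - l) * measure Q3 (\<Union>i. A i))"
      by (intro sums_add sums_mult)
    with u(1) show ?case
      unfolding union(3) by (rule sums_unique2)
  qed
qed

section \<open>The path space of hypotheses and noise\<close>

text \<open>Hypotheses and noise are bundled into one point of a single product space, so that
  claims on their joint law reduce to finitely many coordinates.\<close>

definition coords :: "(2 + 2 \<times> real) set" where
  "coords = range Inl \<union> Inr ` (UNIV \<times> {0..})"

abbreviation path_space :: "((2 + 2 \<times> real) \<Rightarrow> real) measure" where
  "path_space \<equiv> PiM coords (\<lambda>_. borel)"

definition joint_path :: "(2 \<Rightarrow> 'a \<Rightarrow> real) \<Rightarrow> (2 \<Rightarrow> real \<Rightarrow> 'a \<Rightarrow> real) \<Rightarrow> 'a \<Rightarrow> (2 + 2 \<times> real) \<Rightarrow> real" where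
  "joint_path Y W \<omega> = restrict (case_sum (\<lambda>i. Y i \<omega>) (\<lambda>(i, t). W i t \<omega>)) coords"

lemma joint_path_simps [simp]:
  "joint_path Y W \<omega> (Inl i) = Y i \<omega>"
  "t \<ge> 0 \<Longrightarrow> joint_path Y W \<omega> (Inr (i, t)) = W i t \<omega>"
  by (auto simp: joint_path_def coords_def)

lemma coords_iff [simp]: "Inl i \<in> coords" "Inr (i, t) \<in> coords \<longleftrightarrow> t \<ge> 0"
  by (auto simp: coords_def)

lemma measurable_joint_path:
  assumes "\<And>i. Y i \<in> borel_measurable M" "\<And>i t. t \<ge> 0 \<Longrightarrow> W i t \<in> borel_measurable M"
  shows "joint_path Y W \<in> measurable M path_space"
  unfolding joint_path_def by (rule measurable_restrict) (auto simp: coords_def assms)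

locale testing =
  fixes M :: "'a measure"
    and P :: "real^2 \<Rightarrow> 'a measure"
    and Y :: "2 \<Rightarrow> 'a \<Rightarrow> real"
    and W :: "2 \<Rightarrow> real \<Rightarrow> 'a \<Rightarrow> real"
    and \<mu> :: "real^2"
  assumes model: "testing_model M P Y W"
begin

lemma Y_measurable [measurable]: "Y i \<in> borel_measurable M"
  and Y_values: "\<omega> \<in> space M \<Longrightarrow> Y i \<omega> = 0 \<or> Y i \<omega> = 1"
  and W_measurable: "t \<ge> 0 \<Longrightarrow> W i t \<in> borel_measurable M"
  using model by (auto simp: testing_model_def)

context
  fixes \<pi> :: "real^2"
  assumes \<pi>: "\<pi> \<in> cbox 0 1"
begin

lemma prob_space_P: "prob_space (P \<pi>)"
  and sets_P [measurable_cong]: "sets (P \<pi>) = sets M"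
  and Y_prob: "measure (P \<pi>) {\<omega> \<in> space M. Y i \<omega> = 1} = \<pi> $ i"
  and W_brownian: "brownian_motion (P \<pi>) (W i)"
  using model \<pi> by (auto simp: testing_model_def)

lemma space_P: "space (P \<pi>) = space M"
  using sets_P by (rule sets_eq_imp_space_eq)

end

section \<open>Cylinder probabilities in the model\<close>

text \<open>Wiener measure of a cylinder set. Prior \<open>0\<close> and coordinate \<open>1\<close>
  are arbitrary representatives, as \<open>wiener_eq\<close> shows.\<close>

definition wiener :: "real set \<Rightarrow> (real \<Rightarrow> real set) \<Rightarrow> real" where
  "wiener S B = measure (P 0) {\<omega> \<in> space M. \<forall>t\<in>S. W 1 t \<omega> \<in> B t}"

lemma wiener_eq:
  assumes "\<pi> \<in> cbox 0 1" "finite S" "S \<subseteq> {0..}" "\<And>t. t \<in> S \<Longrightarrow> B t \<in> sets borel"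
  shows "measure (P \<pi>) {\<omega> \<in> space M. \<forall>t\<in>S. W i t \<omega> \<in> B t} = wiener S B"
proof -
  have 0: "0 \<in> cbox (0 :: real^2) 1" by (simp add: mem_box_cart)
  show ?thesis
    unfolding wiener_def
    using brownian_motion_cylinder_eq[OF prob_space_P[OF assms(1)] prob_space_P[OF 0]
        W_brownian[OF assms(1)] W_brownian[OF 0] assms(2-4)]
    by (simp add: space_P assms(1) 0)
qed

lemma wiener_uminus:
  assumes "finite S" "S \<subseteq> {0..}" "\<And>t. t \<in> S \<Longrightarrow> B t \<in> sets borel"
  shows "wiener S (\<lambda>t. {x. - x \<in> B t}) = wiener S B"
proof -
  have 0: "0 \<in> cbox (0 :: real^2) 1" by (simp add: mem_box_cart)
  show ?thesis
    unfolding wiener_def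
    using brownian_motion_cylinder_eq[OF prob_space_P[OF 0] prob_space_P[OF 0]
        brownian_motion_uminus[OF prob_space_P[OF 0] W_brownian[OF 0]] W_brownian[OF 0] assms]
    by (simp add: space_P 0)
qed

text \<open>Bernoulli weights times Wiener weights. The prior enters through the first product only,
  and this is affine in each \<open>\<pi> $ i\<close>.\<close>

definition cylinder_prob :: "real^2 \<Rightarrow> (2 \<Rightarrow> real set) \<Rightarrow> real set \<Rightarrow> (2 \<Rightarrow> real \<Rightarrow> real set) \<Rightarrow> real" where
  "cylinder_prob \<pi> A S B =
     (\<Prod>i\<in>UNIV. \<pi> $ i * indicator (A i) 1 + (1 - \<pi> $ i) * indicator (A i) 0) * (\<Prod>i\<in>UNIV. wiener S (B i))"

text \<open>The event is an intersection of four events, one from each of the independent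
  sigma-algebras, so its probability factorises.\<close>

lemma measure_cylinder:
  assumes \<pi>: "\<pi> \<in> cbox 0 1" and A: "\<And>i. A i \<in> sets borel"
    and S: "finite S" "S \<subseteq> {0..}" and B: "\<And>i t. t \<in> S \<Longrightarrow> B i t \<in> sets borel"
  shows "measure (P \<pi>) {\<omega> \<in> space M. \<forall>i. Y i \<omega> \<in> A i \<and> (\<forall>t\<in>S. W i t \<omega> \<in> B i t)} = cylinder_prob \<pi> A S B"
proof -
  interpret prob_space "P \<pi>" by (rule prob_space_P[OF \<pi>])
  note [measurable_cong] = sets_P[OF \<pi>] and [simp] = space_P[OF \<pi>]
  define E where "E = case_sum (\<lambda>i. {\<omega> \<in> space M. Y i \<omega> \<in> A i})
                          (\<lambda>i. {\<omega> \<in> space M. \<forall>t\<in>S. W i t \<omega> \<in> B i t})"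
  have indep: "indep_sets (case_sum (\<lambda>i. sets (generated_sigma M Y {i}))
       (\<lambda>i. sets (generated_sigma M (W i) {0..}))) (UNIV :: (2 + 2) set)"
    using model \<pi> by (auto simp: testing_model_def)
  have E: "E j \<in> case_sum (\<lambda>i. sets (generated_sigma M Y {i}))
       (\<lambda>i. sets (generated_sigma M (W i) {0..})) j" for j
  proof (cases j)
    case (Inl i)
    have "Y i -` A i \<inter> space (generated_sigma M Y {i}) \<in> sets (generated_sigma M Y {i})"
      by (rule measurable_sets[OF measurable_generated_sigma A]) simp
    then show ?thesis using Inl by (simp add: E_def vimage_def Int_def conj_commute)
  next
    case (Inr i)
    have "{\<omega> \<in> space (generated_sigma M (W i) {0..}). \<forall>t\<in>S. W i t \<omega> \<in> B i t} \<in> sets (generated_sigma M (W i) {0..})"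
    proof (intro sets.sets_Collect_finite_All)
      fix t assume t: "t \<in> S"
      have "W i t -` B i t \<inter> space (generated_sigma M (W i) {0..}) \<in> sets (generated_sigma M (W i) {0..})"
        using t S by (intro measurable_sets[OF measurable_generated_sigma B]) auto
      then show "{\<omega> \<in> space (generated_sigma M (W i) {0..}). W i t \<omega> \<in> B i t} \<in> sets (generated_sigma M (W i) {0..})"
        by (simp add: vimage_def Int_def conj_commute)
    qed (rule S)
    then show ?thesis using Inr by (simp add: E_def)
  qed
  have Yp: "prob {\<omega> \<in> space M. Y i \<omega> \<in> A i} = \<pi> $ i * indicator (A i) 1 + (1 - \<pi> $ i) * indicator (A i) 0" for i
  proof -
    have 1: "prob {\<omega> \<in> space M. Y i \<omega> = 1} = \<pi> $ i" by (rule Y_prob[OF \<pi>])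
    have "{\<omega> \<in> space M. Y i \<omega> = 1} \<in> events" by measurable
    from prob_compl[OF this] have "prob (space M - {\<omega> \<in> space M. Y i \<omega> = 1}) = 1 - \<pi> $ i"
      by (simp add: 1)
    also have "space M - {\<omega> \<in> space M. Y i \<omega> = 1} = {\<omega> \<in> space M. Y i \<omega> = 0}"
      using Y_values by fastforce
    finally have 0: "prob {\<omega> \<in> space M. Y i \<omega> = 0} = 1 - \<pi> $ i" .
    \<comment> \<open>\<open>Y i\<close> takes the values 0 and 1 only, so the event is determined
      by which of these two points lie in \<open>A i\<close>.\<close>
    have *: "{\<omega> \<in> space M. Y i \<omega> \<in> A i} = (if 1 \<in> A i then if 0 \<in> A i then space M else {\<omega> \<in> space M. Y i \<omega> = 1}
        else if 0 \<in> A i then {\<omega> \<in> space M. Y i \<omega> = 0} else {})"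
      using Y_values[of _ i] by (auto, metis+)
    show ?thesis
      unfolding * using 0 1 prob_space by (auto simp: indicator_def)
  qed
  have "{\<omega> \<in> space M. \<forall>i. Y i \<omega> \<in> A i \<and> (\<forall>t\<in>S. W i t \<omega> \<in> B i t)} = (\<Inter>j\<in>UNIV. E j)"
    by (auto simp: E_def split: sum.splits)
  then have "prob {\<omega> \<in> space M. \<forall>i. Y i \<omega> \<in> A i \<and> (\<forall>t\<in>S. W i t \<omega> \<in> B i t)} = (\<Prod>j\<in>UNIV. prob (E j))"
    using indep_setsD[OF indep, of UNIV E] E by simp
  also have "\<dots> = (\<Prod>i\<in>UNIV. prob (E (Inl i))) * (\<Prod>i\<in>UNIV. prob (E (Inr i)))"
    unfolding UNIV_Plus_UNIV[symmetric] by (subst prod.Plus) auto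
  also have "\<dots> = cylinder_prob \<pi> A S B"
    using wiener_eq[OF \<pi> S] B by (simp add: E_def cylinder_prob_def Yp)
  finally show ?thesis .
qed

section \<open>Reflection of the first coordinate\<close>

definition reflect :: "real^2 \<Rightarrow> real^2" where
  "reflect \<pi> = (\<chi> i. if i = 1 then 1 - \<pi> $ i else \<pi> $ i)"

definition YR :: "2 \<Rightarrow> 'a \<Rightarrow> real" where
  "YR i \<omega> = (if i = 1 then 1 - Y i \<omega> else Y i \<omega>)"

definition WR :: "2 \<Rightarrow> real \<Rightarrow> 'a \<Rightarrow> real" where
  "WR i t \<omega> = (if i = 1 then - W i t \<omega> else W i t \<omega>)"

lemma reflect_in_cbox: "\<pi> \<in> cbox 0 1 \<Longrightarrow> reflect \<pi> \<in> cbox 0 1"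
  by (auto simp: mem_box_cart reflect_def)

text \<open>Under the reflected prior, \<open>1 - Y 1\<close> is Bernoulli with parameter
  \<open>\<pi> $ 1\<close> and \<open>- W 1\<close> is again a Brownian motion, so
  \<open>(YR, WR)\<close> has the cylinder probabilities that \<open>(Y, W)\<close> has under
  \<open>P \<pi>\<close>.\<close>

lemma measure_cylinder_reflect:
  assumes \<pi>: "\<pi> \<in> cbox 0 1" and A: "\<And>i. A i \<in> sets borel"
    and S: "finite S" "S \<subseteq> {0..}" and B: "\<And>i t. t \<in> S \<Longrightarrow> B i t \<in> sets borel"
  shows "measure (P (reflect \<pi>)) {\<omega> \<in> space M. \<forall>i. YR i \<omega> \<in> A i \<and> (\<forall>t\<in>S. WR i t \<omega> \<in> B i t)} = cylinder_prob \<pi> A S B"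
proof -
  \<comment> \<open>The reflection is moved from the random variables to the target sets, which
    makes \<open>measure_cylinder\<close> applicable.\<close>
  define A' where "A' i = (if i = 1 then {x. 1 - x \<in> A i} else A i)" for i
  define B' where "B' i t = (if i = 1 then {x. - x \<in> B i t} else B i t)" for i t
  have A': "A' i \<in> sets borel" for i
    using A[of i] by (auto simp: A'_def)
  have B': "B' i t \<in> sets borel" if "t \<in> S" for i t
    using B[of t i] that by (auto simp: B'_def)
  have "{\<omega> \<in> space M. \<forall>i. YR i \<omega> \<in> A i \<and> (\<forall>t\<in>S. WR i t \<omega> \<in> B i t)}
      = {\<omega> \<in> space M. \<forall>i. Y i \<omega> \<in> A' i \<and> (\<forall>t\<in>S. W i t \<omega> \<in> B' i t)}"
    by (auto simp: YR_def WR_def A'_def B'_def split: if_splits)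
  then have "measure (P (reflect \<pi>)) {\<omega> \<in> space M. \<forall>i. YR i \<omega> \<in> A i \<and> (\<forall>t\<in>S. WR i t \<omega> \<in> B i t)}
      = cylinder_prob (reflect \<pi>) A' S B'"
    using measure_cylinder[OF reflect_in_cbox[OF \<pi>] A' S B'] by simp
  also have "\<dots> = cylinder_prob \<pi> A S B"
    unfolding cylinder_prob_def
  proof (intro arg_cong2[where f = "(*)"] prod.cong refl)
    show "wiener S (B' i) = wiener S (B i)" for i
    proof -
      have "B' i = (if i = 1 then \<lambda>t. {x. - x \<in> B i t} else B i)" by (auto simp: B'_def fun_eq_iff)
      then show ?thesis using wiener_uminus[OF S, of "B i"] B by auto
    qed
  qed (auto simp: reflect_def A'_def indicator_def)
  finally show ?thesis .
qed

section \<open>Laws on path space\<close>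

definition law :: "real^2 \<Rightarrow> ((2 + 2 \<times> real) \<Rightarrow> real) measure" where
  "law \<pi> = distr (P \<pi>) path_space (joint_path Y W)"

definition lawR :: "real^2 \<Rightarrow> ((2 + 2 \<times> real) \<Rightarrow> real) measure" where
  "lawR \<pi> = distr (P (reflect \<pi>)) path_space (joint_path YR WR)"

lemma path_measurable: "joint_path Y W \<in> measurable M path_space"
  by (intro measurable_joint_path W_measurable Y_measurable)

lemma pathR_measurable: "joint_path YR WR \<in> measurable M path_space"
  by (intro measurable_joint_path) (use W_measurable in \<open>auto simp: YR_def[abs_def] WR_def[abs_def]\<close>)

lemma measure_law:
  assumes "\<pi> \<in> cbox 0 1" "E \<in> sets path_space"
  shows "measure (law \<pi>) E = measure (P \<pi>) (joint_path Y W -` E \<inter> space M)"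
    "measure (lawR \<pi>) E = measure (P (reflect \<pi>)) (joint_path YR WR -` E \<inter> space M)"
  using assms path_measurable pathR_measurable
  by (simp_all add: law_def lawR_def measure_distr space_P sets_P reflect_in_cbox cong: measurable_cong_sets)

lemma law_prob:
  assumes "\<pi> \<in> cbox 0 1"
  shows "prob_space (law \<pi>)" "prob_space (lawR \<pi>)"
  using assms path_measurable pathR_measurable
  by (auto simp: law_def lawR_def sets_P reflect_in_cbox cong: measurable_cong_sets
      intro!: prob_space.prob_space_distr prob_space_P)

text \<open>The preimage of a cylinder is the same event for every prior. One choice of
  \<open>A\<close>, \<open>S\<close>, \<open>B\<close> therefore serves all \<open>\<pi>\<close> and
  both laws, which lets different priors be compared.\<close>

lemma law_cylinder:
  assumes J: "finite J" "J \<subseteq> coords" and X: "X \<in> (\<Pi> j\<in>J. sets borel)"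
  obtains A S B where
    "\<And>\<pi>. \<pi> \<in> cbox 0 1 \<Longrightarrow> measure (law \<pi>) (prod_emb coords (\<lambda>_. borel) J (Pi\<^sub>E J X)) = cylinder_prob \<pi> A S B"
    "\<And>\<pi>. \<pi> \<in> cbox 0 1 \<Longrightarrow> measure (lawR \<pi>) (prod_emb coords (\<lambda>_. borel) J (Pi\<^sub>E J X)) = cylinder_prob \<pi> A S B"
proof
  define A where "A i = (if Inl i \<in> J then X (Inl i) else UNIV)" for i
  \<comment> \<open>\<open>S\<close> collects the times of both noise coordinates; a pair of
    coordinate and time that \<open>J\<close> does not constrain receives the target
    \<open>UNIV\<close>.\<close>
  define S where "S = {t. \<exists>i. Inr (i, t) \<in> J}"
  define B where "B i t = (if Inr (i, t) \<in> J then X (Inr (i, t)) else UNIV)" for i t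
  have "S \<subseteq> (\<lambda>j. snd (projr j)) ` J" by (force simp: S_def)
  then have "finite S" using J(1) by (rule finite_subset[OF _ finite_imageI])
  then have S: "finite S" "S \<subseteq> {0..}" using J(2) by (auto simp: S_def)
  have AB: "A i \<in> sets borel" "B i t \<in> sets borel" for i t using X by (auto simp: A_def B_def)
  have E: "prod_emb coords (\<lambda>_. borel) J (Pi\<^sub>E J X) \<in> sets path_space"
    using J X by (intro sets_PiM_I) auto
  have *: "joint_path Y' W' -` prod_emb coords (\<lambda>_. borel) J (Pi\<^sub>E J X) \<inter> space M
     = {\<omega> \<in> space M. \<forall>i. Y' i \<omega> \<in> A i \<and> (\<forall>t\<in>S. W' i t \<omega> \<in> B i t)}" for Y' W'
  proof -
    have 1: "joint_path Y' W' \<omega> \<in> prod_emb coords (\<lambda>_. borel) J (Pi\<^sub>E J X) \<longleftrightarrow> (\<forall>j\<in>J. joint_path Y' W' \<omega> j \<in> X j)" for \<omega>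
      using J(2) by (auto simp: prod_emb_def joint_path_def PiE_iff)
    have 2: "(\<forall>j\<in>J. joint_path Y' W' \<omega> j \<in> X j) \<longleftrightarrow> (\<forall>i. Y' i \<omega> \<in> A i \<and> (\<forall>t\<in>S. W' i t \<omega> \<in> B i t))" for \<omega>
    proof (intro iffI allI conjI ballI)
      fix j assume *: "\<forall>i. Y' i \<omega> \<in> A i \<and> (\<forall>t\<in>S. W' i t \<omega> \<in> B i t)" and j: "j \<in> J"
      then have "j \<in> coords" using J by auto
      with * j show "joint_path Y' W' \<omega> j \<in> X j"
        by (cases j) (auto simp: A_def B_def S_def split: if_splits, metis+)
    next
      fix i t assume *: "\<forall>j\<in>J. joint_path Y' W' \<omega> j \<in> X j" and t: "t \<in> S"
      then show "W' i t \<omega> \<in> B i t" using S by (force simp: B_def)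
    next
      fix i assume *: "\<forall>j\<in>J. joint_path Y' W' \<omega> j \<in> X j"
      then show "Y' i \<omega> \<in> A i" by (force simp: A_def)
    qed
    show ?thesis by (auto simp: 1 2)
  qed
  show "measure (law \<pi>) (prod_emb coords (\<lambda>_. borel) J (Pi\<^sub>E J X)) = cylinder_prob \<pi> A S B"
    "measure (lawR \<pi>) (prod_emb coords (\<lambda>_. borel) J (Pi\<^sub>E J X)) = cylinder_prob \<pi> A S B"
    if \<pi>: "\<pi> \<in> cbox 0 1" for \<pi>
    by (simp_all add: measure_law[OF \<pi> E] * measure_cylinder[OF \<pi> AB(1) S AB(2)]
        measure_cylinder_reflect[OF \<pi> AB(1) S AB(2)])
qed

text \<open>On cylinders only the Bernoulli weight of coordinate \<open>i\<close> varies among the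
  three priors, and it is affine; \<open>PiM_prob_convex_eqI\<close> extends the identity to all
  path events.\<close>

lemma law_affine:
  assumes \<pi>: "\<pi> \<in> cbox 0 1" "\<pi>' \<in> cbox 0 1" "\<pi>'' \<in> cbox 0 1"
    and i: "\<pi> $ i = l * \<pi>' $ i + (1 - l) * \<pi>'' $ i"
    and j: "\<And>j. j \<noteq> i \<Longrightarrow> \<pi>' $ j = \<pi> $ j \<and> \<pi>'' $ j = \<pi> $ j"
    and E: "E \<in> sets path_space"
  shows "measure (law \<pi>) E = l * measure (law \<pi>') E + (1 - l) * measure (law \<pi>'') E"
proof (rule PiM_prob_convex_eqI[OF law_prob(1)[OF \<pi>(1)] law_prob(1)[OF \<pi>(2)] law_prob(1)[OF \<pi>(3)] _ _ _ _ E])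
  fix J X assume J: "finite J" "J \<subseteq> coords" and X: "X \<in> (\<Pi> j\<in>J. sets (borel :: real measure))"
  from law_cylinder[OF this] obtain A S B where
    *: "\<And>\<pi>. \<pi> \<in> cbox 0 1 \<Longrightarrow> measure (law \<pi>) (prod_emb coords (\<lambda>_. borel) J (Pi\<^sub>E J X)) = cylinder_prob \<pi> A S B"
    by metis
  have "cylinder_prob \<pi> A S B = l * cylinder_prob \<pi>' A S B + (1 - l) * cylinder_prob \<pi>'' A S B"
  proof -
    define a where "a p k = p $ k * indicator (A k) 1 + (1 - p $ k) * indicator (A k) 0" for p :: "real^2" and k
    have eq: "cylinder_prob p A S B = a p 1 * a p 2 * (\<Prod>i\<in>UNIV. wiener S (B i))" for p
      by (simp add: cylinder_prob_def a_def UNIV_2)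
    have ai: "a \<pi> i = l * a \<pi>' i + (1 - l) * a \<pi>'' i"
      unfolding a_def i by (simp add: algebra_simps)
    have aj: "a \<pi>' k = a \<pi> k" "a \<pi>'' k = a \<pi> k" if "k \<noteq> i" for k
      using j[OF that] by (simp_all add: a_def)
    consider "i = 1" | "i = 2" using exhaust_2 by blast
    then show ?thesis
    proof cases
      case 1
      have "cylinder_prob \<pi> A S B = (l * a \<pi>' 1 + (1 - l) * a \<pi>'' 1) * a \<pi> 2 * (\<Prod>i\<in>UNIV. wiener S (B i))"
        using ai 1 by (simp add: eq)
      also have "\<dots> = l * cylinder_prob \<pi>' A S B + (1 - l) * cylinder_prob \<pi>'' A S B"
        using aj[of 2] 1 by (simp add: eq algebra_simps)
      finally show ?thesis .
    next
      case 2
      have "cylinder_prob \<pi> A S B = a \<pi> 1 * (l * a \<pi>' 2 + (1 - l) * a \<pi>'' 2) * (\<Prod>i\<in>UNIV. wiener S (B i))"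
        using ai 2 by (simp add: eq)
      also have "\<dots> = l * cylinder_prob \<pi>' A S B + (1 - l) * cylinder_prob \<pi>'' A S B"
        using aj[of 1] 2 by (simp add: eq algebra_simps)
      finally show ?thesis .
    qed
  qed
  then show "measure (law \<pi>) (prod_emb coords (\<lambda>_. borel) J (Pi\<^sub>E J X)) =
      l * measure (law \<pi>') (prod_emb coords (\<lambda>_. borel) J (Pi\<^sub>E J X))
      + (1 - l) * measure (law \<pi>'') (prod_emb coords (\<lambda>_. borel) J (Pi\<^sub>E J X))"
    by (simp add: * \<pi>)
qed (simp_all add: law_def)

lemma law_reflect:
  assumes \<pi>: "\<pi> \<in> cbox 0 1" and E: "E \<in> sets path_space"
  shows "measure (law \<pi>) E = measure (lawR \<pi>) E"
proof -
  \<comment> \<open>Equality is phrased as a degenerate affine combination with weight 1, so that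
    the same Dynkin argument applies.\<close>
  have "measure (law \<pi>) E = 1 * measure (lawR \<pi>) E + (1 - 1) * measure (lawR \<pi>) E"
  proof (rule PiM_prob_convex_eqI[OF law_prob(1)[OF \<pi>] law_prob(2)[OF \<pi>] law_prob(2)[OF \<pi>] _ _ _ _ E])
    fix J X assume J: "finite J" "J \<subseteq> coords" and X: "X \<in> (\<Pi> j\<in>J. sets (borel :: real measure))"
    from law_cylinder[OF this] obtain A S B where
      "\<And>\<pi>. \<pi> \<in> cbox 0 1 \<Longrightarrow> measure (law \<pi>) (prod_emb coords (\<lambda>_. borel) J (Pi\<^sub>E J X)) = cylinder_prob \<pi> A S B"
      "\<And>\<pi>. \<pi> \<in> cbox 0 1 \<Longrightarrow> measure (lawR \<pi>) (prod_emb coords (\<lambda>_. borel) J (Pi\<^sub>E J X)) = cylinder_prob \<pi> A S B"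
      by metis
    then show "measure (law \<pi>) (prod_emb coords (\<lambda>_. borel) J (Pi\<^sub>E J X)) =
        1 * measure (lawR \<pi>) (prod_emb coords (\<lambda>_. borel) J (Pi\<^sub>E J X))
        + (1 - 1) * measure (lawR \<pi>) (prod_emb coords (\<lambda>_. borel) J (Pi\<^sub>E J X))"
      by (simp add: \<pi>)
  qed (simp_all add: law_def lawR_def)
  then show ?thesis by simp
qed

section \<open>Observable events as path events\<close>

abbreviation "F \<equiv> observed_filtration M (observation \<mu> Y W)"

lemma space_F [simp]: "space (F t) = space M"
  by (simp add: observed_filtration_def)

lemma sets_F_mono: "s \<le> t \<Longrightarrow> sets (F s) \<subseteq> sets (F t)"
  unfolding observed_filtration_def by (rule sets_generated_sigma_mono) auto

lemma sets_F_subset: "sets (F t) \<subseteq> sets M"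
  unfolding observed_filtration_def
  by (rule sets_generated_sigma_subset) (auto simp: observation_def[abs_def] intro!: borel_measurable_add W_measurable)

lemma observation_measurable:
  "0 \<le> s \<Longrightarrow> ennreal s \<le> t \<Longrightarrow> observation \<mu> Y W i s \<in> borel_measurable (F t)"
  unfolding observed_filtration_def
  using measurable_generated_sigma[of "(i, s)" "UNIV \<times> {s. 0 \<le> s \<and> ennreal s \<le> t}" "\<lambda>(i, s). observation \<mu> Y W i s" M]
  by simp

text \<open>Induction over the generated sigma-algebra. The second conjunct transports policies: the
  path event that describes \<open>E\<close>, read along the reflected path, is still observable at
  the same time.\<close>

lemma sets_F_path:
  assumes "E \<in> sets (F t)"
  shows "\<exists>B\<in>sets path_space. joint_path Y W -` B \<inter> space M = E \<and> joint_path YR WR -` B \<inter> space M \<in> sets (F t)"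
  using assms unfolding observed_filtration_def sets_generated_sigma
proof (induction rule: sigma_sets.induct)
  case (Basic E)
  then obtain i s A where s: "0 \<le> s" "ennreal s \<le> t" and A [measurable]: "A \<in> sets borel"
    and E: "E = observation \<mu> Y W i s -` A \<inter> space M" by auto
  define B where "B = {z \<in> space path_space. \<mu> $ i * z (Inl i) * s + z (Inr (i, s)) \<in> A}"
  have [measurable]: "(\<lambda>z. z (Inl i)) \<in> borel_measurable path_space" "(\<lambda>z. z (Inr (i, s))) \<in> borel_measurable path_space"
    using s by (auto intro!: measurable_component_singleton)
  have "B \<in> sets path_space" unfolding B_def by measurable
  moreover have "joint_path Y' W' \<omega> \<in> space path_space" for Y' W' and \<omega> :: 'a
    by (auto simp: joint_path_def space_PiM)
  then have *: "joint_path Y' W' -` B \<inter> space M = {\<omega> \<in> space M. observation \<mu> Y' W' i s \<omega> \<in> A}" for Y' W'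
    using s by (auto simp: B_def observation_def)
  have [measurable]: "observation \<mu> Y W i s \<in> borel_measurable (F t)" using s by (rule observation_measurable)
  \<comment> \<open>For coordinate 1 the reflected observation is \<open>\<mu> $ 1 * s\<close> minus
    the actual one, hence a function of what is observed at time \<open>s\<close>.\<close>
  have eq: "observation \<mu> YR WR i s = (\<lambda>\<omega>. if i = 1 then \<mu> $ i * s - observation \<mu> Y W i s \<omega> else observation \<mu> Y W i s \<omega>)"
    by (auto simp: fun_eq_iff observation_def YR_def WR_def algebra_simps)
  have "{\<omega> \<in> space (F t). observation \<mu> YR WR i s \<omega> \<in> A} \<in> sets (F t)"
  proof (cases "i = 1")
    case True
    show ?thesis unfolding eq if_P[OF True] by measurable
  next
    case False
    show ?thesis unfolding eq if_not_P[OF False] by measurable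
  qed
  ultimately show ?case
    using E by (intro bexI[of _ B]) (auto simp: * observed_filtration_def sets_generated_sigma)
next
  case Empty
  show ?case by (intro bexI[of _ "{}"]) (auto intro: sigma_sets.Empty)
next
  case (Compl E)
  then obtain B where B: "B \<in> sets path_space" "joint_path Y W -` B \<inter> space M = E"
    and R: "joint_path YR WR -` B \<inter> space M \<in> sets (F t)"
    by (auto simp: observed_filtration_def sets_generated_sigma)
  have sp: "joint_path Y' W' \<omega> \<in> space path_space" for Y' W' and \<omega> :: 'a
    by (auto simp: joint_path_def space_PiM)
  have "joint_path YR WR -` (space path_space - B) \<inter> space M = space (F t) - (joint_path YR WR -` B \<inter> space M)"
    using sp by auto
  also have "\<dots> \<in> sets (F t)" using R by (rule sets.compl_sets)
  finally have "joint_path YR WR -` (space path_space - B) \<inter> space M \<in> sets (F t)" .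
  then show ?case using B sp
    by (intro bexI[of _ "space path_space - B"]) (auto simp: observed_filtration_def sets_generated_sigma)
next
  case (Union E)
  then have "\<forall>n. \<exists>B\<in>sets path_space. joint_path Y W -` B \<inter> space M = E n \<and> joint_path YR WR -` B \<inter> space M \<in> sets (F t)"
    by (simp add: observed_filtration_def sets_generated_sigma)
  then obtain B where B: "\<And>n. B n \<in> sets path_space" "\<And>n. joint_path Y W -` B n \<inter> space M = E n"
    and R: "\<And>n. joint_path YR WR -` B n \<inter> space M \<in> sets (F t)"
    by metis
  have "joint_path YR WR -` (\<Union>n. B n) \<inter> space M = (\<Union>n. joint_path YR WR -` B n \<inter> space M)" by auto
  also have "\<dots> \<in> sets (F t)" using R by (intro sets.countable_nat_UN) blast
  finally have "joint_path YR WR -` (\<Union>n. B n) \<inter> space M \<in> sets (F t)" .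
  moreover have "joint_path Y W -` (\<Union>n. B n) \<inter> space M = (\<Union>n. E n)"
    unfolding B(2)[symmetric] by auto
  moreover have "(\<Union>n. B n) \<in> sets path_space" using B(1) by auto
  ultimately show ?case
    unfolding observed_filtration_def sets_generated_sigma by blast
qed

end

section \<open>Policies on a time grid\<close>

text \<open>Exchanging sum and integral leaves, at almost every point, a sum with a single nonzero
  term: the one of the piece containing the point.\<close>

lemma nn_integral_partition:
  fixes A :: "'j::countable \<Rightarrow> 'a set"
  assumes A [measurable]: "\<And>j. A j \<in> sets N" and ae: "AE \<omega> in N. \<exists>!j. \<omega> \<in> A j"
    and f [measurable]: "\<And>j. f j \<in> borel_measurable N"
  shows "(\<integral>\<^sup>+j. \<integral>\<^sup>+\<omega>. f j \<omega> * indicator (A j) \<omega> \<partial>N \<partial>count_space UNIV)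
     = (\<integral>\<^sup>+\<omega>. f (THE j. \<omega> \<in> A j) \<omega> \<partial>N)"
proof -
  have "(\<integral>\<^sup>+j. \<integral>\<^sup>+\<omega>. f j \<omega> * indicator (A j) \<omega> \<partial>N \<partial>count_space UNIV)
      = (\<integral>\<^sup>+\<omega>. \<integral>\<^sup>+j. f j \<omega> * indicator (A j) \<omega> \<partial>count_space UNIV \<partial>N)"
    by (rule nn_integral_count_space_nn_integral[symmetric]) auto
  also have "\<dots> = (\<integral>\<^sup>+\<omega>. f (THE j. \<omega> \<in> A j) \<omega> \<partial>N)"
    using ae
  proof (intro nn_integral_cong_AE, eventually_elim)
    case (elim \<omega>)
    then obtain k where k: "\<omega> \<in> A k" "\<And>j. \<omega> \<in> A j \<Longrightarrow> j = k" by auto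
    then have the: "(THE j. \<omega> \<in> A j) = k" by blast
    have "(\<integral>\<^sup>+j. f j \<omega> * indicator (A j) \<omega> \<partial>count_space UNIV) = (\<Sum>j\<in>{k}. f j \<omega> * indicator (A j) \<omega>)"
    proof (rule nn_integral_count_space')
      fix j assume "j \<notin> {k}"
      then have "\<omega> \<notin> A j" using k(2) by blast
      then show "f j \<omega> * indicator (A j) \<omega> = 0" by simp
    qed simp_all
    then show ?case using k(1) by (simp add: the)
  qed
  finally show ?thesis .
qed

text \<open>The decision \<open>(i, v)\<close> declares \<open>Y i = 1\<close> if \<open>v\<close> is false and \<open>Y i = 0\<close> if \<open>v\<close> is true;
  the terminal cost is the smallest of the four posterior probabilities of a wrong decision.\<close>

definition loss :: "2 \<times> bool \<Rightarrow> real^2 \<Rightarrow> real" where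
  "loss d x = (if snd d then x $ fst d else 1 - x $ fst d)"

text \<open>An explicit minimiser of \<open>loss\<close> with ties broken in a fixed order; as a
  case distinction on comparisons it is measurable.\<close>

definition best_decision :: "real \<Rightarrow> real \<Rightarrow> 2 \<times> bool" where
  "best_decision a b =
     (if a \<le> 1 - a \<and> a \<le> b \<and> a \<le> 1 - b then (1, True)
      else if 1 - a \<le> a \<and> 1 - a \<le> b \<and> 1 - a \<le> 1 - b then (1, False)
      else if b \<le> 1 - b then (2, True) else (2, False))"

lemma terminal_cost_le_loss: "terminal_cost x \<le> loss d x"
proof -
  consider "fst d = 1" | "fst d = 2" using exhaust_2 by blast
  then show ?thesis by cases (simp_all add: terminal_cost_def loss_def min_le_iff_disj)
qed

lemma loss_best_decision: "loss (best_decision (x $ 1) (x $ 2)) x = terminal_cost x"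
  unfolding terminal_cost_def loss_def best_decision_def by simp linarith

lemma measurable_best_decision [measurable]:
  assumes [measurable]: "f \<in> borel_measurable N" "g \<in> borel_measurable N"
  shows "(\<lambda>\<omega>. best_decision (f \<omega>) (g \<omega>)) \<in> measurable N (count_space UNIV)"
  unfolding best_decision_def by measurable

locale testing_problem = testing M P Y W \<mu>
  for M :: "'a measure" and P Y W \<mu> +
  fixes Post :: "real^2 \<Rightarrow> 2 \<Rightarrow> real \<Rightarrow> 'a \<Rightarrow> real" and c :: real
  assumes post: "\<And>\<pi>. \<pi> \<in> cbox 0 1 \<Longrightarrow> posterior_process (P \<pi>) F Y (Post \<pi>)"
    and c_pos: "c > 0"
begin

abbreviation "V \<equiv> value_function P F Post c"

section \<open>Grid policies and the posterior form of their cost\<close>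

definition wrong :: "2 \<times> bool \<Rightarrow> 'a set" where
  "wrong d = {\<omega> \<in> space M. Y (fst d) \<omega> = (if snd d then 1 else 0)}"

lemma wrong_measurable: "wrong d \<in> sets M"
  unfolding wrong_def by measurable

text \<open>A grid policy stops at time \<open>h * k\<close> with decision \<open>d\<close> on the event \<open>A (k, d)\<close>.\<close>

definition grid_policy :: "real^2 \<Rightarrow> real \<Rightarrow> (nat \<times> 2 \<times> bool \<Rightarrow> 'a set) \<Rightarrow> bool" where
  "grid_policy \<pi> h A \<longleftrightarrow>
     (\<forall>j. A j \<in> sets (F (ennreal (h * real (fst j))))) \<and> (AE \<omega> in P \<pi>. \<exists>!j. \<omega> \<in> A j)"

text \<open>Probability of a wrong decision plus expected observation cost, written through
  probabilities of events alone. No posterior occurs, so for fixed events the cost is affine in the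
  law.\<close>

definition cost :: "real^2 \<Rightarrow> real \<Rightarrow> (nat \<times> 2 \<times> bool \<Rightarrow> 'a set) \<Rightarrow> ennreal" where
  "cost \<pi> h A = (\<integral>\<^sup>+j. emeasure (P \<pi>) (A j \<inter> wrong (snd j))
      + ennreal (c * (h * real (fst j))) * emeasure (P \<pi>) (A j) \<partial>count_space UNIV)"

lemma grid_policy_F: "grid_policy \<pi> h A \<Longrightarrow> A j \<in> sets (F (ennreal (h * real (fst j))))"
  unfolding grid_policy_def by blast

lemma grid_policy_sets: "grid_policy \<pi> h A \<Longrightarrow> A j \<in> sets M"
  using grid_policy_F sets_F_subset by blast

lemma grid_policy_AE: "grid_policy \<pi> h A \<Longrightarrow> AE \<omega> in P \<pi>. \<exists>!j. \<omega> \<in> A j"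
  unfolding grid_policy_def by blast

text \<open>The loss at time \<open>t\<close> is almost surely the conditional probability of
  \<open>wrong d\<close> given the observations up to \<open>t\<close>; integrating it over an
  observable event gives back the probability.\<close>

lemma posterior_loss:
  assumes \<pi>: "\<pi> \<in> cbox 0 1" and t: "t \<ge> 0" and A: "A \<in> sets (F (ennreal t))"
  shows "(\<integral>\<^sup>+\<omega>. ennreal (loss d (\<chi> i. Post \<pi> i t \<omega>)) * indicator A \<omega> \<partial>P \<pi>) = emeasure (P \<pi>) (A \<inter> wrong d)"
proof -
  let ?N = "P \<pi>" and ?G = "F (ennreal t)"
  interpret prob_space ?N by (rule prob_space_P[OF \<pi>])
  note [measurable_cong] = sets_P[OF \<pi>] and [simp] = space_P[OF \<pi>]
  interpret finite_measure_subalgebra ?N ?G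
    by standard (auto simp: subalgebra_def sets_P[OF \<pi>] sets_F_subset[THEN subsetD])
  have AM [measurable]: "A \<in> sets M" using A sets_F_subset by blast
  \<comment> \<open>\<open>U\<close> equals the indicator of \<open>wrong d\<close> but is affine in
    \<open>Y\<close>, so its conditional expectation follows from the one that defines the
    posterior.\<close>
  define U where "U \<omega> = (if snd d then Y (fst d) \<omega> else 1 - Y (fst d) \<omega>)" for \<omega>
  have U [measurable]: "U \<in> borel_measurable M" unfolding U_def[abs_def] by measurable
  have U_ind: "U \<omega> = indicator (wrong d) \<omega>" if "\<omega> \<in> space M" for \<omega>
    using Y_values[OF that, of "fst d"] that by (auto simp: U_def wrong_def)
  have int: "integrable ?N f" if "f \<in> borel_measurable M" "\<And>\<omega>. \<omega> \<in> space M \<Longrightarrow> \<bar>f \<omega>\<bar> \<le> 1" for f :: "'a \<Rightarrow> real"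
    using that by (intro integrable_const_bound[of _ 1]) auto
  have intU: "integrable ?N U" by (rule int) (auto simp: U_ind indicator_def)
  have intY: "integrable ?N (Y i)" for i by (rule int) (use Y_values[of _ i] in fastforce)+
  have Q: "AE \<omega> in ?N. Post \<pi> i t \<omega> = real_cond_exp ?N ?G (Y i) \<omega>" for i
    using post[OF \<pi>] t by (auto simp: posterior_process_def)
  have loss: "AE \<omega> in ?N. loss d (\<chi> i. Post \<pi> i t \<omega>) = real_cond_exp ?N ?G U \<omega>"
  proof (cases "snd d")
    case True
    then show ?thesis using Q[of "fst d"] by (simp add: U_def[abs_def] loss_def)
  next
    case False
    have "AE \<omega> in ?N. real_cond_exp ?N ?G U \<omega> = real_cond_exp ?N ?G (\<lambda>_. 1) \<omega> - real_cond_exp ?N ?G (Y (fst d)) \<omega>"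
      using False real_cond_exp_diff[OF integrable_const intY, of 1] by (simp add: U_def[abs_def])
    moreover have "AE \<omega> in ?N. real_cond_exp ?N ?G (\<lambda>_. 1) \<omega> = 1"
      by (rule real_cond_exp_F_meas) auto
    ultimately show ?thesis using Q[of "fst d"]
      by eventually_elim (use False in \<open>simp add: loss_def\<close>)
  qed
  have pos: "AE \<omega> in ?N. 0 \<le> real_cond_exp ?N ?G U \<omega>"
    by (rule real_cond_exp_ge_c[OF intU]) (auto simp: U_ind)
  have "(\<integral>\<^sup>+\<omega>. ennreal (loss d (\<chi> i. Post \<pi> i t \<omega>)) * indicator A \<omega> \<partial>?N)
      = (\<integral>\<^sup>+\<omega>. ennreal (indicator A \<omega> * real_cond_exp ?N ?G U \<omega>) \<partial>?N)"
    using loss by (intro nn_integral_cong_AE, eventually_elim) (auto simp: indicator_def)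
  also have "\<dots> = ennreal (\<integral>\<omega>. indicator A \<omega> * real_cond_exp ?N ?G U \<omega> \<partial>?N)"
  proof (rule nn_integral_eq_integral)
    show "integrable ?N (\<lambda>\<omega>. indicator A \<omega> * real_cond_exp ?N ?G U \<omega>)"
      using integrable_mult_indicator[of A ?N "real_cond_exp ?N ?G U"] real_cond_exp_int(1)[OF intU] by auto
    show "AE \<omega> in ?N. 0 \<le> indicator A \<omega> * real_cond_exp ?N ?G U \<omega>"
      using pos by eventually_elim auto
  qed
  also have "(\<integral>\<omega>. indicator A \<omega> * real_cond_exp ?N ?G U \<omega> \<partial>?N) = (\<integral>\<omega>. indicator A \<omega> * U \<omega> \<partial>?N)"
    using real_cond_exp_intA[OF intU A] by (simp add: set_lebesgue_integral_def)
  also have "\<dots> = (\<integral>\<omega>. indicator (A \<inter> wrong d) \<omega> \<partial>?N)"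
    by (rule Bochner_Integration.integral_cong) (auto simp: U_ind indicator_def)
  also have "ennreal \<dots> = emeasure ?N (A \<inter> wrong d)"
    using AM wrong_measurable[of d] by (simp add: emeasure_eq_measure sets_P[OF \<pi>])
  finally show ?thesis .
qed

lemma post_measurable:
  assumes "\<pi> \<in> cbox 0 1" "t \<ge> 0"
  shows "Post \<pi> i t \<in> borel_measurable (F (ennreal t))" "Post \<pi> i t \<in> borel_measurable M"
proof -
  show "Post \<pi> i t \<in> borel_measurable (F (ennreal t))"
    using post[OF assms(1)] assms(2) by (auto simp: posterior_process_def)
  then show "Post \<pi> i t \<in> borel_measurable M"
    by (rule measurable_from_subalg[rotated]) (simp add: subalgebra_def sets_F_subset)
qed

definition stopped_loss :: "real^2 \<Rightarrow> real \<Rightarrow> nat \<times> 2 \<times> bool \<Rightarrow> 'a \<Rightarrow> ennreal" where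
  "stopped_loss \<pi> h j \<omega> = ennreal (loss (snd j) (\<chi> i. Post \<pi> i (h * real (fst j)) \<omega>))
     + ennreal (c * (h * real (fst j)))"

lemma cost_eq:
  assumes \<pi>: "\<pi> \<in> cbox 0 1" and h: "h > 0" and A: "grid_policy \<pi> h A"
  shows "cost \<pi> h A = (\<integral>\<^sup>+\<omega>. stopped_loss \<pi> h (THE j. \<omega> \<in> A j) \<omega> \<partial>P \<pi>)"
proof -
  note [measurable_cong] = sets_P[OF \<pi>]
  have [measurable]: "A j \<in> sets M" for j using A by (rule grid_policy_sets)
  have [measurable]: "(\<lambda>\<omega>. loss (snd j) (\<chi> i. Post \<pi> i (h * real (fst j)) \<omega>)) \<in> borel_measurable M" for j
    using post_measurable(2)[OF \<pi>, of "h * real (fst j)"] h by (cases "snd (snd j)") (auto simp: loss_def)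
  have "cost \<pi> h A = (\<integral>\<^sup>+j. \<integral>\<^sup>+\<omega>. stopped_loss \<pi> h j \<omega> * indicator (A j) \<omega> \<partial>P \<pi> \<partial>count_space UNIV)"
    unfolding cost_def
  proof (intro nn_integral_cong)
    fix j
    have "(\<integral>\<^sup>+\<omega>. stopped_loss \<pi> h j \<omega> * indicator (A j) \<omega> \<partial>P \<pi>)
        = (\<integral>\<^sup>+\<omega>. ennreal (loss (snd j) (\<chi> i. Post \<pi> i (h * real (fst j)) \<omega>)) * indicator (A j) \<omega>
            + ennreal (c * (h * real (fst j))) * indicator (A j) \<omega> \<partial>P \<pi>)"
      by (simp add: stopped_loss_def distrib_right)
    also have "\<dots> = emeasure (P \<pi>) (A j \<inter> wrong (snd j)) + ennreal (c * (h * real (fst j))) * emeasure (P \<pi>) (A j)"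
    proof (subst nn_integral_add)
      from posterior_loss[OF \<pi> _ grid_policy_F[OF A]] h
      show "(\<integral>\<^sup>+\<omega>. ennreal (loss (snd j) (\<chi> i. Post \<pi> i (h * real (fst j)) \<omega>)) * indicator (A j) \<omega> \<partial>P \<pi>)
          + (\<integral>\<^sup>+\<omega>. ennreal (c * (h * real (fst j))) * indicator (A j) \<omega> \<partial>P \<pi>)
        = emeasure (P \<pi>) (A j \<inter> wrong (snd j)) + ennreal (c * (h * real (fst j))) * emeasure (P \<pi>) (A j)"
        by (simp add: nn_integral_cmult_indicator sets_P[OF \<pi>])
    qed measurable
    finally show "emeasure (P \<pi>) (A j \<inter> wrong (snd j)) + ennreal (c * (h * real (fst j))) * emeasure (P \<pi>) (A j)
        = (\<integral>\<^sup>+\<omega>. stopped_loss \<pi> h j \<omega> * indicator (A j) \<omega> \<partial>P \<pi>)" ..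
  qed
  also have "\<dots> = (\<integral>\<^sup>+\<omega>. stopped_loss \<pi> h (THE j. \<omega> \<in> A j) \<omega> \<partial>P \<pi>)"
    using A by (intro nn_integral_partition) (auto simp: stopped_loss_def[abs_def] grid_policy_def sets_P[OF \<pi>])
  finally show ?thesis .
qed

section \<open>The value function as an infimum over grid policies\<close>

text \<open>A grid policy induces a stopping time, and there the terminal cost is at most the loss
  of the decision actually taken.\<close>

lemma V_le_cost:
  assumes \<pi>: "\<pi> \<in> cbox 0 1" and h: "h > 0" and A: "grid_policy \<pi> h A"
  shows "V \<pi> \<le> cost \<pi> h A"
proof -
  \<comment> \<open>The events of a policy partition the space only almost surely, whereas a
    stopping time is constrained at every sample point. With \<open>LEAST\<close>, and
    \<open>\<infinity>\<close> off all events, \<open>T_le\<close> holds everywhere.\<close>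
  define T where "T \<omega> = (if \<exists>j. \<omega> \<in> A j then ennreal (h * real (LEAST k. \<exists>d. \<omega> \<in> A (k, d))) else \<infinity>)" for \<omega>
  have ae: "AE \<omega> in P \<pi>. \<exists>!j. \<omega> \<in> A j" using A by (rule grid_policy_AE)
  have T_eq: "T \<omega> = ennreal (h * real (fst (THE j. \<omega> \<in> A j)))" if "\<exists>!j. \<omega> \<in> A j" for \<omega>
  proof -
    from ex1_implies_ex[OF that] obtain j where j: "\<omega> \<in> A j" by (elim exE)
    have the: "(THE j. \<omega> \<in> A j) = j" using that j by (rule the1_equality)
    have uniq: "j' = j" if "\<omega> \<in> A j'" for j'
      using the1_equality[OF \<open>\<exists>!j. \<omega> \<in> A j\<close> that] the by simp
    have "(LEAST k. \<exists>d. \<omega> \<in> A (k, d)) = fst j"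
    proof (rule Least_equality)
      show "\<exists>d. \<omega> \<in> A (fst j, d)" using j by (intro exI[of _ "snd j"]) simp
      show "fst j \<le> k" if "\<exists>d. \<omega> \<in> A (k, d)" for k using that uniq by fastforce
    qed
    moreover have "\<exists>j. \<omega> \<in> A j" using j by blast
    ultimately show ?thesis by (simp only: T_def the if_True)
  qed
  have T_le: "T \<omega> \<le> t \<longleftrightarrow> t = \<infinity> \<or> (\<exists>j. \<omega> \<in> A j \<and> ennreal (h * real (fst j)) \<le> t)" for \<omega> t
  proof (cases "\<exists>j. \<omega> \<in> A j")
    case True
    let ?P = "\<lambda>k. \<exists>d. \<omega> \<in> A (k, d)"
    from True have "\<exists>k. ?P k" by (metis prod.collapse)
    from LeastI_ex[OF this] obtain d where d: "\<omega> \<in> A (Least ?P, d)" by (elim exE)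
    have T: "T \<omega> = ennreal (h * real (Least ?P))" by (simp only: T_def True if_True)
    have least: "T \<omega> \<le> ennreal (h * real (fst j))" if "\<omega> \<in> A j" for j
    proof -
      have "?P (fst j)" using that by (metis prod.collapse)
      then have "Least ?P \<le> fst j" by (rule Least_le)
      then show ?thesis unfolding T using h by (intro ennreal_leI) simp
    qed
    show ?thesis
    proof
      show "t = \<infinity> \<or> (\<exists>j. \<omega> \<in> A j \<and> ennreal (h * real (fst j)) \<le> t)" if "T \<omega> \<le> t"
        using d that by (intro disjI2 exI[of _ "(Least ?P, d)"]) (simp add: T)
      show "T \<omega> \<le> t" if "t = \<infinity> \<or> (\<exists>j. \<omega> \<in> A j \<and> ennreal (h * real (fst j)) \<le> t)"
        using that least order_trans top_greatest unfolding infinity_ennreal_def by metis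
    qed
  next
    case False
    then show ?thesis by (auto simp: T_def top_unique)
  qed
  have "stopping_time F T"
    unfolding stopping_time_def
  proof
    fix t
    have "{\<omega> \<in> space (F t). T \<omega> \<le> t} \<in> sets (F t)"
    proof (cases "t = \<infinity>")
      case False
      have "A j \<in> sets (F t)" if "ennreal (h * real (fst j)) \<le> t" for j
        using grid_policy_F[OF A] sets_F_mono[OF that] by blast
      then have "(\<Union>j\<in>{j. ennreal (h * real (fst j)) \<le> t}. A j) \<in> sets (F t)"
        by (intro sets.countable_UN') auto
      also have "(\<Union>j\<in>{j. ennreal (h * real (fst j)) \<le> t}. A j) = {\<omega> \<in> space (F t). T \<omega> \<le> t}"
        unfolding T_le space_F using False sets.sets_into_space[OF grid_policy_sets[OF A]] by blast
      finally show ?thesis .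
    qed (use sets.top[of "F t"] in \<open>simp add: T_le\<close>)
    then show "Measurable.pred (F t) (\<lambda>\<omega>. T \<omega> \<le> t)" by (simp add: pred_def)
  qed
  moreover have "AE \<omega> in P \<pi>. T \<omega> < \<infinity>"
    using ae by eventually_elim (simp add: T_eq)
  ultimately have "V \<pi> \<le> (\<integral>\<^sup>+\<omega>. ennreal (terminal_cost (\<chi> i. Post \<pi> i (enn2real (T \<omega>)) \<omega>)) + ennreal c * T \<omega> \<partial>P \<pi>)"
    unfolding value_function_def by (intro INF_lower) auto
  also have "\<dots> \<le> (\<integral>\<^sup>+\<omega>. stopped_loss \<pi> h (THE j. \<omega> \<in> A j) \<omega> \<partial>P \<pi>)"
    using ae
  proof (intro nn_integral_mono_AE, eventually_elim)
    case (elim \<omega>)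
    show ?case
      unfolding T_eq[OF elim(2)] stopped_loss_def
    proof (intro add_mono ennreal_leI)
      show "ennreal c * ennreal (h * real (fst (THE j. \<omega> \<in> A j))) \<le> ennreal (c * (h * real (fst (THE j. \<omega> \<in> A j))))"
        using h c_pos by (subst ennreal_mult) auto
    qed (use h in \<open>simp add: terminal_cost_le_loss\<close>)
  qed
  also have "\<dots> = cost \<pi> h A" by (rule cost_eq[OF \<pi> h A, symmetric])
  finally show ?thesis .
qed

text \<open>Decide at time 0, optimally for the prior itself. As a grid policy this has a cost given
  directly by the probability of \<open>Y i = 1\<close>, without identifying the posterior at time
  0.\<close>

lemma V_le_terminal_cost:
  assumes \<pi>: "\<pi> \<in> cbox 0 1"
  shows "V \<pi> \<le> ennreal (terminal_cost \<pi>)"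
proof -
  interpret prob_space "P \<pi>" by (rule prob_space_P[OF \<pi>])
  define d where "d = best_decision (\<pi> $ 1) (\<pi> $ 2)"
  define A where "A j = (if j = (0, d) then space M else {})" for j :: "nat \<times> 2 \<times> bool"
  have "grid_policy \<pi> 1 A"
    unfolding grid_policy_def
  proof
    show "AE \<omega> in P \<pi>. \<exists>!j. \<omega> \<in> A j"
      using AE_space by eventually_elim (auto simp: A_def space_P[OF \<pi>])
    show "\<forall>j. A j \<in> sets (F (ennreal (1 * real (fst j))))"
      using sets.top[of "F t" for t] by (auto simp: A_def)
  qed
  from V_le_cost[OF \<pi> _ this] have "V \<pi> \<le> cost \<pi> 1 A" by simp
  also have "cost \<pi> 1 A = (\<Sum>j\<in>{(0, d)}. emeasure (P \<pi>) (A j \<inter> wrong (snd j))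
      + ennreal (c * (1 * real (fst j))) * emeasure (P \<pi>) (A j))"
    unfolding cost_def by (rule nn_integral_count_space') (auto simp: A_def)
  also have "\<dots> = emeasure (P \<pi>) (wrong d)"
    using sets.sets_into_space[OF wrong_measurable, of d] by (simp add: A_def Int_absorb1)
  also have "\<dots> = ennreal (loss d \<pi>)"
  proof (cases "snd d")
    case True
    then show ?thesis by (simp add: wrong_def loss_def emeasure_eq_measure Y_prob[OF \<pi>])
  next
    case False
    have "wrong d = space (P \<pi>) - {\<omega> \<in> space M. Y (fst d) \<omega> = 1}"
      using False Y_values by (fastforce simp: wrong_def space_P[OF \<pi>])
    moreover have "{\<omega> \<in> space M. Y (fst d) \<omega> = 1} \<in> sets (P \<pi>)"
      unfolding sets_P[OF \<pi>] by measurable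
    ultimately show ?thesis
      using False by (simp add: emeasure_eq_measure prob_compl Y_prob[OF \<pi>] loss_def)
  qed
  also have "loss d \<pi> = terminal_cost \<pi>" unfolding d_def by (rule loss_best_decision)
  finally show ?thesis .
qed

text \<open>The converse of \<open>V_le_cost\<close>: the costs of grid policies approximate the
  cost of any admissible stopping time, so a lower bound for the former passes to
  \<open>V\<close>.\<close>

lemma le_V:
  assumes \<pi>: "\<pi> \<in> cbox 0 1"
    and C: "\<And>h A. h > 0 \<Longrightarrow> grid_policy \<pi> h A \<Longrightarrow> C \<le> cost \<pi> h A"
  shows "C \<le> V \<pi>"
  unfolding value_function_def
proof (rule INF_greatest)
  fix \<tau> assume "\<tau> \<in> {\<tau>. stopping_time F \<tau> \<and> (AE \<omega> in P \<pi>. \<tau> \<omega> < \<infinity>)}"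
  then have \<tau>: "stopping_time F \<tau>" and fin: "AE \<omega> in P \<pi>. \<tau> \<omega> < \<infinity>" by auto
  interpret prob_space "P \<pi>" by (rule prob_space_P[OF \<pi>])
  note [measurable_cong] = sets_P[OF \<pi>] and sp = space_P[OF \<pi>]
  have \<tau>_le: "{\<omega> \<in> space M. \<tau> \<omega> \<le> t} \<in> sets (F t)" for t
    using \<tau> by (auto simp: stopping_time_def pred_def)
  then have [measurable]: "\<tau> \<in> borel_measurable M"
    using sets_F_subset by (intro borel_measurableI_le) blast
  define h :: "nat \<Rightarrow> real" where "h n = 1 / 2 ^ n" for n
  have h: "h n > 0" for n by (simp add: h_def)
  have h0: "h \<longlonglongrightarrow> 0"
    unfolding h_def using LIMSEQ_inverse_realpow_zero[of 2] by (simp add: inverse_eq_divide)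
  \<comment> \<open>Index of the first grid point not before \<open>\<tau>\<close>. Since
    \<open>enn2real \<infinity> = 0\<close>, this index is 0 where
    \<open>\<tau> = \<infinity>\<close>; the events \<open>A\<close> therefore also demand
    \<open>\<tau> \<omega> < \<infinity>\<close>.\<close>
  define k where "k n \<omega> = nat \<lceil>enn2real (\<tau> \<omega>) / h n\<rceil>" for n \<omega>
  have k_le: "k n \<omega> \<le> m \<longleftrightarrow> enn2real (\<tau> \<omega>) \<le> h n * real m" for n \<omega> m
  proof -
    have "k n \<omega> \<le> m \<longleftrightarrow> enn2real (\<tau> \<omega>) / h n \<le> real m"
      by (simp add: k_def nat_le_iff ceiling_le_iff)
    also have "\<dots> \<longleftrightarrow> enn2real (\<tau> \<omega>) \<le> h n * real m"
      using h[of n] by (simp add: field_simps)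
    finally show ?thesis .
  qed
  have k_bounds: "enn2real (\<tau> \<omega>) \<le> h n * real (k n \<omega>)" "h n * real (k n \<omega>) \<le> enn2real (\<tau> \<omega>) + h n" for n \<omega>
  proof -
    show "enn2real (\<tau> \<omega>) \<le> h n * real (k n \<omega>)" using k_le[of n \<omega> "k n \<omega>"] by simp
    have "real (k n \<omega>) = of_int \<lceil>enn2real (\<tau> \<omega>) / h n\<rceil>"
      using h[of n] by (simp add: k_def)
    also have "\<dots> \<le> enn2real (\<tau> \<omega>) / h n + 1" by linarith
    finally show "h n * real (k n \<omega>) \<le> enn2real (\<tau> \<omega>) + h n"
      using h[of n] by (simp add: field_simps)
  qed
  have k_meas [measurable]: "k n \<in> measurable M (count_space UNIV)" for n
    unfolding k_def[abs_def] by measurable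
  let ?d = "\<lambda>n \<omega>. best_decision (Post \<pi> 1 (h n * real (k n \<omega>)) \<omega>) (Post \<pi> 2 (h n * real (k n \<omega>)) \<omega>)"
  define A where "A n j = {\<omega> \<in> space M. \<tau> \<omega> < \<infinity> \<and> j = (k n \<omega>, ?d n \<omega>)}" for n j
  have A_meas: "A n (m, d) \<in> sets (F (ennreal (h n * real m)))" for n m d
  proof -
    let ?G = "F (ennreal (h n * real m))"
    \<comment> \<open>Because times are rounded up, this event is
      \<open>\<tau> \<le> h n * l\<close>, known at that grid time. Rounding down would look into
      the future.\<close>
    have le: "{\<omega> \<in> space M. \<tau> \<omega> < \<infinity> \<and> k n \<omega> \<le> l} \<in> sets ?G" if "l \<le> m" for l
    proof -
      have "\<tau> \<omega> < \<infinity> \<and> k n \<omega> \<le> l \<longleftrightarrow> \<tau> \<omega> \<le> ennreal (h n * real l)" for \<omega>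
        using h[of n] unfolding k_le by (cases "\<tau> \<omega>") (auto simp: top_unique)
      then have "{\<omega> \<in> space M. \<tau> \<omega> < \<infinity> \<and> k n \<omega> \<le> l} = {\<omega> \<in> space M. \<tau> \<omega> \<le> ennreal (h n * real l)}"
        by simp
      also have "\<dots> \<in> sets (F (ennreal (h n * real l)))" by (rule \<tau>_le)
      also have "\<dots> \<subseteq> sets ?G" using that h[of n] by (intro sets_F_mono ennreal_leI) simp
      finally show ?thesis .
    qed
    have "{\<omega> \<in> space M. \<tau> \<omega> < \<infinity> \<and> k n \<omega> = m} \<in> sets ?G"
    proof (cases m)
      case 0
      then show ?thesis using le[of 0] by simp
    next
      case (Suc l)
      have "{\<omega> \<in> space M. \<tau> \<omega> < \<infinity> \<and> k n \<omega> = m}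
         = {\<omega> \<in> space M. \<tau> \<omega> < \<infinity> \<and> k n \<omega> \<le> m} - {\<omega> \<in> space M. \<tau> \<omega> < \<infinity> \<and> k n \<omega> \<le> l}"
        unfolding Suc by auto
      then show ?thesis using le[of m] le[of l] Suc by auto
    qed
    moreover have "{\<omega> \<in> space M. best_decision (Post \<pi> 1 (h n * real m) \<omega>) (Post \<pi> 2 (h n * real m) \<omega>) = d} \<in> sets ?G"
    proof -
      have [measurable]: "Post \<pi> i (h n * real m) \<in> borel_measurable ?G" for i
        using h[of n] by (intro post_measurable[OF \<pi>]) simp
      have "{\<omega> \<in> space ?G. best_decision (Post \<pi> 1 (h n * real m) \<omega>) (Post \<pi> 2 (h n * real m) \<omega>) = d} \<in> sets ?G"
        by measurable
      then show ?thesis by simp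
    qed
    moreover have "A n (m, d) = {\<omega> \<in> space M. \<tau> \<omega> < \<infinity> \<and> k n \<omega> = m}
        \<inter> {\<omega> \<in> space M. best_decision (Post \<pi> 1 (h n * real m) \<omega>) (Post \<pi> 2 (h n * real m) \<omega>) = d}"
      unfolding A_def by auto
    ultimately show ?thesis by (simp only: sets.Int)
  qed
  have A_iff: "AE \<omega> in P \<pi>. \<forall>n j. \<omega> \<in> A n j \<longleftrightarrow> j = (k n \<omega>, ?d n \<omega>)"
    using fin AE_space by eventually_elim (simp add: A_def sp)
  have pol: "grid_policy \<pi> (h n) (A n)" for n
    unfolding grid_policy_def
  proof
    show "\<forall>j. A n j \<in> sets (F (ennreal (h n * real (fst j))))"
    proof
      show "A n j \<in> sets (F (ennreal (h n * real (fst j))))" for j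
        using A_meas[of n "fst j" "snd j"] by simp
    qed
    show "AE \<omega> in P \<pi>. \<exists>!j. \<omega> \<in> A n j"
      using A_iff by eventually_elim (simp only: ex1_eq)
  qed
  define g where "g t \<omega> = ennreal (terminal_cost (\<chi> i. Post \<pi> i t \<omega>))" for t \<omega>
  have g_meas: "g t \<in> borel_measurable M" if "t \<ge> 0" for t
  proof -
    have [measurable]: "Post \<pi> i t \<in> borel_measurable M" for i
      using post_measurable[OF \<pi> that] by simp
    show ?thesis unfolding g_def[abs_def] terminal_cost_def by simp
  qed
  \<comment> \<open>The random time takes values in a countable grid, so measurability at each fixed
    time suffices.\<close>
  have gk_meas [measurable]: "(\<lambda>\<omega>. g (h n * real (k n \<omega>)) \<omega>) \<in> borel_measurable M" for n
    using h[of n] by (intro measurable_compose_countable[where f = "\<lambda>m. g (h n * real m)", OF g_meas k_meas]) simp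
  \<comment> \<open>Rounding delays stopping by at most \<open>h n\<close>, at a price of at most
    \<open>c * h n\<close>, and the best decision turns the loss into the terminal cost.\<close>
  have bound: "C \<le> (\<integral>\<^sup>+\<omega>. g (h n * real (k n \<omega>)) \<omega> \<partial>P \<pi>) + ((\<integral>\<^sup>+\<omega>. ennreal c * \<tau> \<omega> \<partial>P \<pi>) + ennreal (c * h n))" for n
  proof -
    have "C \<le> cost \<pi> (h n) (A n)" by (rule C[OF h pol])
    also have "\<dots> = (\<integral>\<^sup>+\<omega>. stopped_loss \<pi> (h n) (THE j. \<omega> \<in> A n j) \<omega> \<partial>P \<pi>)"
      by (rule cost_eq[OF \<pi> h pol])
    also have "\<dots> \<le> (\<integral>\<^sup>+\<omega>. g (h n * real (k n \<omega>)) \<omega> + (ennreal c * \<tau> \<omega> + ennreal (c * h n)) \<partial>P \<pi>)"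
      using A_iff fin
    proof (intro nn_integral_mono_AE, eventually_elim)
      case (elim \<omega>)
      have the: "(THE j. \<omega> \<in> A n j) = (k n \<omega>, ?d n \<omega>)" using elim(3) by (simp only: the_eq_trivial)
      have "ennreal (c * (h n * real (k n \<omega>))) \<le> ennreal (c * (enn2real (\<tau> \<omega>) + h n))"
        using k_bounds(2)[of n \<omega>] c_pos by (intro ennreal_leI mult_left_mono) auto
      also have "\<dots> = ennreal c * \<tau> \<omega> + ennreal (c * h n)"
        using elim(4) c_pos h[of n] by (simp add: distrib_left ennreal_plus ennreal_mult less_top)
      finally have "ennreal (c * (h n * real (k n \<omega>))) \<le> ennreal c * \<tau> \<omega> + ennreal (c * h n)" .
      moreover have "loss (?d n \<omega>) (\<chi> i. Post \<pi> i (h n * real (k n \<omega>)) \<omega>)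
          = terminal_cost (\<chi> i. Post \<pi> i (h n * real (k n \<omega>)) \<omega>)"
        using loss_best_decision[of "\<chi> i. Post \<pi> i (h n * real (k n \<omega>)) \<omega>"] by simp
      ultimately show ?case
        unfolding the stopped_loss_def g_def by (simp add: add_left_mono)
    qed
    also have "\<dots> = (\<integral>\<^sup>+\<omega>. g (h n * real (k n \<omega>)) \<omega> \<partial>P \<pi>) + ((\<integral>\<^sup>+\<omega>. ennreal c * \<tau> \<omega> \<partial>P \<pi>) + ennreal (c * h n))"
      by (simp add: nn_integral_add emeasure_space_1)
    finally show ?thesis .
  qed
  \<comment> \<open>The posterior is continuous in time only almost surely, so its value at
    \<open>\<tau>\<close> has no immediate measurability. The liminf along the grids is measurable
    and agrees with it almost everywhere.\<close>
  define G where "G \<omega> = liminf (\<lambda>n. g (h n * real (k n \<omega>)) \<omega>)" for \<omega>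
  have G_meas [measurable]: "G \<in> borel_measurable M" unfolding G_def[abs_def] by measurable
  have cont: "AE \<omega> in P \<pi>. \<forall>i. continuous_on {0..} (\<lambda>t. Post \<pi> i t \<omega>)"
    using post[OF \<pi>] by (intro AE_all_countable[THEN iffD2]) (auto simp: posterior_process_def)
  have conv: "AE \<omega> in P \<pi>. (\<lambda>n. g (h n * real (k n \<omega>)) \<omega>) \<longlonglongrightarrow> g (enn2real (\<tau> \<omega>)) \<omega>"
    using cont
  proof eventually_elim
    case (elim \<omega>)
    have "(\<lambda>n. h n * real (k n \<omega>)) \<longlonglongrightarrow> enn2real (\<tau> \<omega>)"
    proof (rule tendsto_sandwich[where f = "\<lambda>_. enn2real (\<tau> \<omega>)" and h = "\<lambda>n. enn2real (\<tau> \<omega>) + h n"])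
      show "(\<lambda>n. enn2real (\<tau> \<omega>) + h n) \<longlonglongrightarrow> enn2real (\<tau> \<omega>)"
        using tendsto_add[OF tendsto_const h0] by simp
    qed (use k_bounds in auto)
    then have "(\<lambda>n. Post \<pi> i (h n * real (k n \<omega>)) \<omega>) \<longlonglongrightarrow> Post \<pi> i (enn2real (\<tau> \<omega>)) \<omega>" for i
      using elim h by (intro continuous_on_tendsto_compose[of "{0..}" "\<lambda>t. Post \<pi> i t \<omega>"])
        (auto intro!: always_eventually mult_nonneg_nonneg less_imp_le[OF h])
    then show ?case
      unfolding g_def terminal_cost_def by (auto intro!: tendsto_intros)
  qed
  then have G_eq: "AE \<omega> in P \<pi>. G \<omega> = g (enn2real (\<tau> \<omega>)) \<omega>"
    by eventually_elim (auto simp: G_def intro!: lim_imp_Liminf)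
  \<comment> \<open>\<open>terminal_cost\<close> is at most 1/2 on the whole plane, so the constant
    1 dominates.\<close>
  have "(\<lambda>n. \<integral>\<^sup>+\<omega>. g (h n * real (k n \<omega>)) \<omega> \<partial>P \<pi>) \<longlonglongrightarrow> (\<integral>\<^sup>+\<omega>. G \<omega> \<partial>P \<pi>)"
  proof (rule nn_integral_dominated_convergence[where w = "\<lambda>_. 1"])
    show "AE \<omega> in P \<pi>. g (h n * real (k n \<omega>)) \<omega> \<le> 1" for n
      unfolding g_def by (intro always_eventually allI ennreal_le_1[THEN iffD2]) (auto simp: terminal_cost_def)
    show "AE \<omega> in P \<pi>. (\<lambda>n. g (h n * real (k n \<omega>)) \<omega>) \<longlonglongrightarrow> G \<omega>"
      using conv G_eq by eventually_elim simp
  qed (simp_all add: emeasure_space_1)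
  moreover have "(\<lambda>n. ennreal (c * h n)) \<longlonglongrightarrow> 0"
    using tendsto_ennrealI[OF tendsto_mult_right_zero[OF h0, of c]] by simp
  ultimately have "(\<lambda>n. (\<integral>\<^sup>+\<omega>. g (h n * real (k n \<omega>)) \<omega> \<partial>P \<pi>) + ((\<integral>\<^sup>+\<omega>. ennreal c * \<tau> \<omega> \<partial>P \<pi>) + ennreal (c * h n)))
      \<longlonglongrightarrow> (\<integral>\<^sup>+\<omega>. G \<omega> \<partial>P \<pi>) + ((\<integral>\<^sup>+\<omega>. ennreal c * \<tau> \<omega> \<partial>P \<pi>) + 0)"
    by (intro tendsto_add tendsto_const)
  from LIMSEQ_le_const[OF this] bound
  have "C \<le> (\<integral>\<^sup>+\<omega>. G \<omega> \<partial>P \<pi>) + (\<integral>\<^sup>+\<omega>. ennreal c * \<tau> \<omega> \<partial>P \<pi>)" by auto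
  also have "\<dots> = (\<integral>\<^sup>+\<omega>. G \<omega> + ennreal c * \<tau> \<omega> \<partial>P \<pi>)"
    by (rule nn_integral_add[symmetric]) measurable
  also have "\<dots> = (\<integral>\<^sup>+\<omega>. ennreal (terminal_cost (\<chi> i. Post \<pi> i (enn2real (\<tau> \<omega>)) \<omega>)) + ennreal c * \<tau> \<omega> \<partial>P \<pi>)"
    using G_eq by (intro nn_integral_cong_AE) (auto simp: g_def)
  finally show "C \<le> \<dots>" .
qed

section \<open>Concavity in each coordinate of the prior\<close>

lemma sets_F_vimage: "sets (F t) \<subseteq> sets (vimage_algebra (space M) (joint_path Y W) path_space)"
proof
  fix E assume "E \<in> sets (F t)"
  from sets_F_path[OF this] show "E \<in> sets (vimage_algebra (space M) (joint_path Y W) path_space)"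
    using in_vimage_algebra by blast
qed

lemma wrong_path:
  obtains B where "B \<in> sets path_space"
    "joint_path Y W -` B \<inter> space M = wrong (i, v)"
    "joint_path YR WR -` B \<inter> space M = wrong (i, if i = 1 then \<not> v else v)"
proof
  let ?B = "{z \<in> space path_space. z (Inl i) = (if v then 1 else 0)}"
  have sp: "joint_path Y' W' \<omega> \<in> space path_space" for Y' W' and \<omega> :: 'a
    by (auto simp: joint_path_def space_PiM)
  have [measurable]: "(\<lambda>z. z (Inl i)) \<in> borel_measurable path_space"
    by (intro measurable_component_singleton) simp
  show "?B \<in> sets path_space" by measurable
  show "joint_path Y W -` ?B \<inter> space M = wrong (i, v)"
    using sp by (auto simp: wrong_def)
  show "joint_path YR WR -` ?B \<inter> space M = wrong (i, if i = 1 then \<not> v else v)"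
    using sp by (auto simp: wrong_def YR_def)
qed

text \<open>\<open>testing_model\<close> ties the laws of different priors together only through the
  joint law of \<open>(Y, W)\<close>, hence the restriction to events of the joint path.\<close>

lemma P_affine:
  assumes \<pi>: "\<pi> \<in> cbox 0 1" "\<pi>' \<in> cbox 0 1" "\<pi>'' \<in> cbox 0 1" and l: "0 \<le> l" "l \<le> 1"
    and i: "\<pi> $ i = l * \<pi>' $ i + (1 - l) * \<pi>'' $ i"
    and j: "\<And>j. j \<noteq> i \<Longrightarrow> \<pi>' $ j = \<pi> $ j \<and> \<pi>'' $ j = \<pi> $ j"
    and E: "E \<in> sets (vimage_algebra (space M) (joint_path Y W) path_space)"
  shows "emeasure (P \<pi>) E = ennreal l * emeasure (P \<pi>') E + ennreal (1 - l) * emeasure (P \<pi>'') E"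
proof -
  have sp: "joint_path Y W \<in> space M \<rightarrow> space path_space"
    by (auto simp: joint_path_def space_PiM)
  obtain B where B: "B \<in> sets path_space" and EB: "E = joint_path Y W -` B \<inter> space M"
    using E unfolding sets_vimage_algebra2[OF sp] by blast
  interpret p: prob_space "P \<pi>" by (rule prob_space_P[OF \<pi>(1)])
  interpret p': prob_space "P \<pi>'" by (rule prob_space_P[OF \<pi>(2)])
  interpret p'': prob_space "P \<pi>''" by (rule prob_space_P[OF \<pi>(3)])
  have "measure (P \<pi>) E = l * measure (P \<pi>') E + (1 - l) * measure (P \<pi>'') E"
    using law_affine[OF \<pi> i j B] by (simp add: measure_law B \<pi> EB)
  then show ?thesis
    using l by (simp add: p.emeasure_eq_measure p'.emeasure_eq_measure p''.emeasure_eq_measure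
        ennreal_plus ennreal_mult)
qed

text \<open>A grid policy for \<open>\<pi>\<close> is used unchanged for \<open>\<pi>'\<close> and
  \<open>\<pi>''\<close>. Its cost is affine in the law, and the value is at most the cost for each
  of the two priors.\<close>

lemma V_concave:
  assumes \<pi>: "\<pi> \<in> cbox 0 1" "\<pi>' \<in> cbox 0 1" "\<pi>'' \<in> cbox 0 1" and l: "0 < l" "l < 1"
    and i: "\<pi> $ i = l * \<pi>' $ i + (1 - l) * \<pi>'' $ i"
    and j: "\<And>j. j \<noteq> i \<Longrightarrow> \<pi>' $ j = \<pi> $ j \<and> \<pi>'' $ j = \<pi> $ j"
  shows "ennreal l * V \<pi>' + ennreal (1 - l) * V \<pi>'' \<le> V \<pi>"
proof (rule le_V[OF \<pi>(1)])
  fix h A assume h: "h > 0" and A: "grid_policy \<pi> h A"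
  let ?G = "vimage_algebra (space M) (joint_path Y W) path_space"
  have aff: "emeasure (P \<pi>) E = ennreal l * emeasure (P \<pi>') E + ennreal (1 - l) * emeasure (P \<pi>'') E"
    if "E \<in> sets ?G" for E
    using P_affine[OF \<pi> _ _ i j that] l by simp
  have AG [measurable]: "A j \<in> sets ?G" for j using grid_policy_F[OF A] sets_F_vimage by blast
  have wG: "wrong d \<in> sets ?G" for d
    using wrong_path[of "fst d" "snd d"] in_vimage_algebra by (metis prod.collapse)
  \<comment> \<open>\<open>N\<close> is the set where the events fail to single out one index. It is
    null under \<open>P \<pi>\<close>; as both weights are positive, it is null under the other two
    laws, so the family is a policy there too.\<close>
  define N where "N = {\<omega> \<in> space ?G. \<not> (\<exists>!j. \<omega> \<in> A j)}"
  have NG: "N \<in> sets ?G" unfolding N_def Ex1_def by measurable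
  have GM: "sets ?G \<subseteq> sets M"
    using path_measurable by (intro sets_image_in_sets) auto
  have "N \<in> null_sets (P \<pi>)"
  proof -
    have "AE \<omega> in P \<pi>. \<omega> \<notin> N"
      using grid_policy_AE[OF A] by eventually_elim (simp add: N_def)
    then show ?thesis using NG GM sets_P[OF \<pi>(1)] by (subst AE_iff_null_sets) auto
  qed
  then have "ennreal l * emeasure (P \<pi>') N + ennreal (1 - l) * emeasure (P \<pi>'') N = 0"
    using aff[OF NG] by auto
  then have N0: "emeasure (P \<pi>') N = 0" "emeasure (P \<pi>'') N = 0" using l by auto
  have pol: "grid_policy p h A" if "emeasure (P p) N = 0" "p \<in> cbox 0 1" for p
  proof -
    have "AE \<omega> in P p. \<omega> \<notin> N"
      using that NG GM sets_P[OF that(2)] by (intro AE_not_in) (auto simp: null_sets_def)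
    moreover have "AE \<omega> in P p. \<omega> \<in> space M" using AE_space[of "P p"] by (simp only: space_P[OF that(2)])
    ultimately have "AE \<omega> in P p. \<exists>!j. \<omega> \<in> A j"
      by eventually_elim (simp only: N_def mem_Collect_eq space_vimage_algebra simp_thms not_not)
    then show ?thesis using grid_policy_F[OF A] unfolding grid_policy_def by blast
  qed
  have "ennreal l * V \<pi>' + ennreal (1 - l) * V \<pi>'' \<le> ennreal l * cost \<pi>' h A + ennreal (1 - l) * cost \<pi>'' h A"
    using V_le_cost[OF \<pi>(2) h pol[OF N0(1) \<pi>(2)]] V_le_cost[OF \<pi>(3) h pol[OF N0(2) \<pi>(3)]]
    by (intro add_mono mult_left_mono) auto
  also have "\<dots> = cost \<pi> h A"
    unfolding cost_def
    by (simp add: nn_integral_cmult[symmetric] nn_integral_add[symmetric] aff sets.Int[OF AG wG] AG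
        distrib_left mult_ac add_ac)
  finally show "ennreal l * V \<pi>' + ennreal (1 - l) * V \<pi>'' \<le> cost \<pi> h A" .
qed

section \<open>Symmetry under reflection\<close>

text \<open>Each event of a policy is described by a path event, which is then read along the
  reflected path. \<open>sets_F_path\<close> keeps it observable and \<open>law_reflect\<close>
  keeps its probability.\<close>

lemma V_reflect_le:
  assumes \<pi>: "\<pi> \<in> cbox 0 1"
  shows "V (reflect \<pi>) \<le> V \<pi>"
proof (rule le_V[OF \<pi>])
  fix h A assume h: "h > 0" and A: "grid_policy \<pi> h A"
  note r\<pi> = reflect_in_cbox[OF \<pi>]
  interpret p: prob_space "P \<pi>" by (rule prob_space_P[OF \<pi>])
  interpret r: prob_space "P (reflect \<pi>)" by (rule prob_space_P[OF r\<pi>])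
  have law: "emeasure (P (reflect \<pi>)) (joint_path YR WR -` B \<inter> space M) = emeasure (P \<pi>) (joint_path Y W -` B \<inter> space M)"
    if "B \<in> sets path_space" for B
    using law_reflect[OF \<pi> that] by (simp add: measure_law[OF \<pi> that] p.emeasure_eq_measure r.emeasure_eq_measure)
  have "\<forall>j. \<exists>B\<in>sets path_space. joint_path Y W -` B \<inter> space M = A j
      \<and> joint_path YR WR -` B \<inter> space M \<in> sets (F (ennreal (h * real (fst j))))"
    using sets_F_path[OF grid_policy_F[OF A]] by blast
  then obtain B where B [measurable]: "\<And>j. B j \<in> sets path_space"
    and BA: "\<And>j. joint_path Y W -` B j \<inter> space M = A j"
    and BR: "\<And>j. joint_path YR WR -` B j \<inter> space M \<in> sets (F (ennreal (h * real (fst j))))"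
    by metis
  \<comment> \<open>Reflection exchanges \<open>Y 1 = 0\<close> and \<open>Y 1 = 1\<close>, so
    verdicts on coordinate 1 are inverted and those on coordinate 2 stay.\<close>
  define flip :: "nat \<times> 2 \<times> bool \<Rightarrow> nat \<times> 2 \<times> bool"
    where "flip = (\<lambda>(k, i, v). (k, i, if i = 1 then \<not> v else v))"
  have flip_flip: "flip (flip j) = j" and fst_flip: "fst (flip j) = fst j" for j
    by (cases j; simp add: flip_def)+
  have flip_bij: "bij_betw flip UNIV UNIV"
    by (rule bij_betw_byWitness[where f' = flip]) (auto simp: flip_flip)
  define R where "R j = joint_path YR WR -` B j \<inter> space M" for j
  define A' where "A' j = R (flip j)" for j
  have cost_eq: "cost (reflect \<pi>) h A' = cost \<pi> h A"
  proof -
    have "emeasure (P (reflect \<pi>)) (R j \<inter> wrong (snd (flip j))) = emeasure (P \<pi>) (A j \<inter> wrong (snd j))" for j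
    proof -
      obtain m i v where jd: "j = (m, i, v)" by (cases j)
      from wrong_path[of i v] obtain E where E: "E \<in> sets path_space"
        "joint_path Y W -` E \<inter> space M = wrong (i, v)"
        "joint_path YR WR -` E \<inter> space M = wrong (i, if i = 1 then \<not> v else v)" by metis
      have 1: "R j \<inter> wrong (snd (flip j)) = joint_path YR WR -` (B j \<inter> E) \<inter> space M"
        unfolding R_def using E(3) by (auto simp: jd flip_def)
      have 2: "A j \<inter> wrong (snd j) = joint_path Y W -` (B j \<inter> E) \<inter> space M"
        unfolding BA[symmetric] using E(2) by (auto simp: jd)
      show ?thesis unfolding 1 2 by (rule law) (use E(1) in auto)
    qed
    moreover have "emeasure (P (reflect \<pi>)) (R j) = emeasure (P \<pi>) (A j)" for j
      using law[OF B, of j] by (simp add: R_def BA)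
    ultimately have "cost \<pi> h A = (\<integral>\<^sup>+j. emeasure (P (reflect \<pi>)) (R j \<inter> wrong (snd (flip j)))
      + ennreal (c * (h * real (fst j))) * emeasure (P (reflect \<pi>)) (R j) \<partial>count_space UNIV)"
      by (simp add: cost_def)
    \<comment> \<open>Reindexing by the involution \<open>flip\<close>, which keeps the grid time,
      turns the sum into the cost of \<open>A'\<close>.\<close>
    also have "\<dots> = (\<integral>\<^sup>+j. emeasure (P (reflect \<pi>)) (R (flip j) \<inter> wrong (snd (flip (flip j))))
      + ennreal (c * (h * real (fst (flip j)))) * emeasure (P (reflect \<pi>)) (R (flip j)) \<partial>count_space UNIV)"
      by (rule nn_integral_bij_count_space[OF flip_bij, symmetric])
    also have "\<dots> = cost (reflect \<pi>) h A'"
      by (simp add: cost_def A'_def flip_flip fst_flip)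
    finally show ?thesis ..
  qed
  \<comment> \<open>The almost sure partition is encoded as a null set of paths, so that equality of
    the laws carries it over.\<close>
  define N where "N = {z \<in> space path_space. \<not> (\<exists>!j. z \<in> B j)}"
  have N: "N \<in> sets path_space" unfolding N_def Ex1_def by measurable
  have sp: "joint_path Y' W' \<omega> \<in> space path_space" for Y' W' and \<omega> :: 'a
    by (auto simp: joint_path_def space_PiM)
  have "AE \<omega> in P \<pi>. \<omega> \<notin> joint_path Y W -` N \<inter> space M"
    using grid_policy_AE[OF A] by eventually_elim (auto simp only: N_def BA[symmetric] Int_iff vimage_eq mem_Collect_eq simp_thms)
  then have "joint_path Y W -` N \<inter> space M \<in> null_sets (P \<pi>)"
    using measurable_sets[OF path_measurable N] sets_P[OF \<pi>] by (subst AE_iff_null_sets) auto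
  then have "emeasure (P \<pi>) (joint_path Y W -` N \<inter> space M) = 0" by auto
  then have "emeasure (P (reflect \<pi>)) (joint_path YR WR -` N \<inter> space M) = 0"
    by (simp add: law[OF N])
  then have "AE \<omega> in P (reflect \<pi>). \<omega> \<notin> joint_path YR WR -` N \<inter> space M"
    using measurable_sets[OF pathR_measurable N] sets_P[OF r\<pi>] by (intro AE_not_in) (auto simp: null_sets_def)
  moreover have "AE \<omega> in P (reflect \<pi>). \<omega> \<in> space M"
    using AE_space[of "P (reflect \<pi>)"] by (simp only: space_P[OF r\<pi>])
  ultimately have ae: "AE \<omega> in P (reflect \<pi>). \<exists>!j. \<omega> \<in> A' j"
  proof eventually_elim
    case (elim \<omega>)
    then have "\<exists>!j. \<omega> \<in> R j" using sp[of YR WR \<omega>] by (simp only: N_def R_def Int_iff vimage_eq mem_Collect_eq simp_thms not_not)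
    then obtain j where j: "\<omega> \<in> R j" "\<And>j'. \<omega> \<in> R j' \<Longrightarrow> j' = j" by (elim ex1E) metis
    show ?case
    proof (rule ex1I[of _ "flip j"])
      show "\<omega> \<in> A' (flip j)" using j(1) by (simp add: A'_def flip_flip)
      show "j' = flip j" if "\<omega> \<in> A' j'" for j'
        using j(2)[of "flip j'"] that flip_flip[of j'] unfolding A'_def by metis
    qed
  qed
  have "grid_policy (reflect \<pi>) h A'"
    unfolding grid_policy_def
  proof
    show "\<forall>j. A' j \<in> sets (F (ennreal (h * real (fst j))))"
    proof
      show "A' j \<in> sets (F (ennreal (h * real (fst j))))" for j
        using BR[of "flip j"] by (simp add: A'_def R_def fst_flip)
    qed
  qed (rule ae)
  from V_le_cost[OF r\<pi> h this] show "V (reflect \<pi>) \<le> cost \<pi> h A"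
    by (simp add: cost_eq)
qed

lemma V_reflect:
  assumes "\<pi> \<in> cbox 0 1"
  shows "V (reflect \<pi>) = V \<pi>"
proof (rule antisym)
  have "reflect (reflect \<pi>) = \<pi>" by (simp add: reflect_def vec_eq_iff)
  then show "V \<pi> \<le> V (reflect \<pi>)"
    using V_reflect_le[OF reflect_in_cbox[OF assms]] by simp
qed (rule V_reflect_le[OF assms])

end

section \<open>The stopping boundary\<close>

lemma concave_onD_unit:
  fixes f :: "real \<Rightarrow> real"
  assumes "concave_on S f" "s \<in> S" "t \<in> S" "0 \<le> u" "u \<le> 1"
  shows "u * f s + (1 - u) * f t \<le> f (u * s + (1 - u) * t)"
proof -
  have "u * f s + (1 - u) * f t \<le> f (u *\<^sub>R s + (1 - u) *\<^sub>R t)"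
    using assms unfolding concave_on_iff by simp
  then show ?thesis by simp
qed

text \<open>Compare with the chord from \<open>y\<close> to the endpoint beyond \<open>x\<close>,
  where \<open>f\<close> is nonnegative: this gives \<open>f x \<ge> u * f y\<close>. The drop is at
  most \<open>(1 - u) * f y\<close>, and bounding \<open>f y\<close> by the distance from
  \<open>y\<close> to that endpoint yields exactly \<open>\<bar>y - x\<bar>\<close>.\<close>

lemma concave_lipschitz:
  fixes f :: "real \<Rightarrow> real"
  assumes conc: "concave_on {0..1} f"
    and f: "\<And>x. x \<in> {0..1} \<Longrightarrow> 0 \<le> f x" "\<And>x. x \<in> {0..1} \<Longrightarrow> f x \<le> min x (1 - x)"
    and xy: "x \<in> {0..1}" "y \<in> {0..1}"
  shows "f y - f x \<le> \<bar>y - x\<bar>"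
proof -
  note c = concave_onD_unit[OF conc]
  consider "x = y" | "x < y" | "y < x" by linarith
  then show ?thesis
  proof cases
    case 2
    define u where "u = x / y"
    have u: "0 \<le> u" "u \<le> 1" "u * y = x" using 2 xy by (auto simp: u_def)
    have "u * f y \<le> u * f y + (1 - u) * f 0" using u f(1)[of 0] by simp
    also have "\<dots> \<le> f x" using c[of y 0 u] xy u by simp
    finally have "f y - f x \<le> (1 - u) * f y" by (simp add: algebra_simps)
    also have "\<dots> \<le> (1 - u) * y" using u f(2)[OF xy(2)] by (intro mult_left_mono) auto
    also have "\<dots> = y - x" using u by (simp add: algebra_simps)
    finally show ?thesis using 2 by simp
  next
    case 3
    define u where "u = (1 - x) / (1 - y)"
    have u: "0 \<le> u" "u \<le> 1" "u * (1 - y) = 1 - x" using 3 xy by (auto simp: u_def)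
    have "u * f y \<le> u * f y + (1 - u) * f 1" using u f(1)[of 1] by simp
    also have "\<dots> \<le> f (u * y + (1 - u) * 1)" using c[of y 1 u] xy u by simp
    also have "u * y + (1 - u) * 1 = x" using u by (simp add: algebra_simps)
    finally have "f y - f x \<le> (1 - u) * f y" by (simp add: algebra_simps)
    also have "\<dots> \<le> (1 - u) * (1 - y)" using u f(2)[OF xy(2)] by (intro mult_left_mono) auto
    also have "\<dots> = x - y" using u by (simp add: algebra_simps)
    finally show ?thesis using 3 by simp
  qed simp
qed

lemma biconcave_boundary:
  fixes v :: "real \<Rightarrow> real \<Rightarrow> real"
  assumes conc1: "\<And>q. q \<in> {0..1} \<Longrightarrow> concave_on {0..1} (\<lambda>p. v p q)"
    and conc2: "\<And>p. p \<in> {0..1} \<Longrightarrow> concave_on {0..1} (v p)"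
    and nonneg: "\<And>p q. p \<in> {0..1} \<Longrightarrow> q \<in> {0..1} \<Longrightarrow> 0 \<le> v p q"
    and le: "\<And>p q. p \<in> {0..1} \<Longrightarrow> q \<in> {0..1} \<Longrightarrow> v p q \<le> min (min p (1 - p)) (min q (1 - q))"
    and sym: "\<And>p q. p \<in> {0..1} \<Longrightarrow> q \<in> {0..1} \<Longrightarrow> v (1 - p) q = v p q"
  obtains b where "\<And>p. p \<in> {0..1} \<Longrightarrow> 0 \<le> b p \<and> b p \<le> min p (1 - p)"
    "upper_semicontinuous_on {0..1} b" "mono_on {0..1/2} b" "\<And>p. p \<in> {0..1} \<Longrightarrow> b p = b (1 - p)"
    "\<And>p q. p \<in> {0..1} \<Longrightarrow> 0 \<le> q \<Longrightarrow> q \<le> min p (1 - p) \<Longrightarrow> v p q = q \<longleftrightarrow> q \<le> b p"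
proof
  define S where "S p = {q \<in> {0..min p (1 - p)}. v p q = q}" for p
  define b where "b p = Sup (S p)" for p
  have lip1: "v y q - v x q \<le> \<bar>y - x\<bar>" if "x \<in> {0..1}" "y \<in> {0..1}" "q \<in> {0..1}" for x y q
    using that le nonneg by (intro concave_lipschitz[OF conc1]) force+
  have lip2: "v p y - v p x \<le> \<bar>y - x\<bar>" if "x \<in> {0..1}" "y \<in> {0..1}" "p \<in> {0..1}" for x y p
    using that le nonneg by (intro concave_lipschitz[OF conc2]) force+
  have v0: "v p 0 = 0" if "p \<in> {0..1}" for p
    using nonneg[of p 0] le[of p 0] that by auto
  have zero: "0 \<in> S p" if "p \<in> {0..1}" for p
    using that by (auto simp: S_def v0)
  have bdd: "bdd_above (S p)" for p by (rule bdd_aboveI[of _ p]) (auto simp: S_def)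
  have S_le: "q \<le> b p" if "q \<in> S p" for p q
    unfolding b_def using that bdd by (rule cSup_upper)
  have b_range: "0 \<le> b p \<and> b p \<le> min p (1 - p)" if p: "p \<in> {0..1}" for p
  proof
    show "0 \<le> b p" by (rule S_le[OF zero[OF p]])
    show "b p \<le> min p (1 - p)" unfolding b_def
    proof (rule cSup_least)
      show "S p \<noteq> {}" using zero[OF p] by blast
    qed (simp add: S_def)
  qed
  \<comment> \<open>The supremum is attained. Otherwise some \<open>q \<in> S p\<close> exceeds the
    midpoint of \<open>v p (b p)\<close> and \<open>b p\<close>, and \<open>v p\<close> would rise
    from \<open>b p\<close> to \<open>q\<close> by more than the distance
    \<open>b p - q\<close>.\<close>
  have b_in: "b p \<in> S p" if p: "p \<in> {0..1}" for p
  proof -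
    note br = b_range[OF p]
    have b1: "b p \<in> {0..1}" using br p by auto
    have "v p (b p) \<ge> b p"
    proof (rule ccontr)
      assume "\<not> v p (b p) \<ge> b p"
      then have "(b p + v p (b p)) / 2 < Sup (S p)" by (simp add: b_def[symmetric])
      then obtain q where q: "q \<in> S p" "(b p + v p (b p)) / 2 < q"
        using less_cSup_iff[OF _ bdd] zero[OF p] by blast
      have "q \<in> {0..1}" "v p q = q" using q(1) p by (auto simp: S_def)
      with lip2[OF b1 _ p, of q] have "q - v p (b p) \<le> \<bar>q - b p\<bar>" by simp
      with S_le[OF q(1)] q(2) show False by simp
    qed
    moreover have "v p (b p) \<le> b p" using le[OF p b1] by simp
    ultimately show ?thesis using br by (simp add: S_def)
  qed
  \<comment> \<open>The chord from \<open>(0, 0)\<close> to \<open>(q, q)\<close> lies on the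
    diagonal; concavity puts \<open>v p\<close> above it and the bound \<open>le\<close> puts it
    below.\<close>
  have down: "q' \<in> S p" if p: "p \<in> {0..1}" and q: "q \<in> S p" "0 \<le> q'" "q' \<le> q" for p q q'
  proof (cases "q = 0")
    case True
    then show ?thesis using q by simp
  next
    case False
    define u where "u = q' / q"
    have u: "0 \<le> u" "u \<le> 1" "u * q = q'" using q False by (auto simp: u_def S_def)
    have q1: "q \<in> {0..1}" "v p q = q" using q p by (auto simp: S_def)
    have "u * v p q + (1 - u) * v p 0 \<le> v p (u * q + (1 - u) * 0)"
      using q1 u by (intro concave_onD_unit[OF conc2[OF p]]) auto
    then have "q' \<le> v p q'" using u q1 v0[OF p] by simp
    moreover have "v p q' \<le> q'" using le[OF p, of q'] q q1 by auto
    ultimately show ?thesis using q by (auto simp: S_def)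
  qed
  show "0 \<le> b p \<and> b p \<le> min p (1 - p)" if "p \<in> {0..1}" for p using that by (rule b_range)
  show "b p = b (1 - p)" if "p \<in> {0..1}" for p
  proof -
    have "S p = S (1 - p)" using sym[OF that] that by (auto simp: S_def)
    then show ?thesis by (simp add: b_def)
  qed
  show "v p q = q \<longleftrightarrow> q \<le> b p" if "p \<in> {0..1}" "0 \<le> q" "q \<le> min p (1 - p)" for p q
  proof
    show "q \<le> b p" if "v p q = q" using \<open>0 \<le> q\<close> \<open>q \<le> min p (1 - p)\<close> that by (intro S_le) (simp add: S_def)
    show "v p q = q" if "q \<le> b p"
      using down[OF \<open>p \<in> {0..1}\<close> b_in[OF \<open>p \<in> {0..1}\<close>] \<open>0 \<le> q\<close> that] by (simp add: S_def)
  qed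
  show "mono_on {0..1/2} b"
  proof (rule mono_onI)
    fix r s :: real assume rs: "r \<in> {0..1/2}" "s \<in> {0..1/2}" "r \<le> s"
    show "b r \<le> b s"
    proof (cases "r = 1/2")
      case True
      then have "r = s" using rs by auto
      then show ?thesis by simp
    next
      case False
      then have r: "r < 1/2" "r \<in> {0..1}" "s \<in> {0..1}" "1 - r \<in> {0..1}" using rs by auto
      \<comment> \<open>\<open>s\<close> is a convex combination of \<open>r\<close> and its mirror
        image \<open>1 - r\<close>, and at both points \<open>v\<close> takes the value
        \<open>b r\<close> at height \<open>b r\<close>. The two points coincide for
        \<open>r = 1/2\<close>, which is why that case is split off.\<close>
      define u where "u = (1 - r - s) / (1 - 2 * r)"
      have u: "0 \<le> u" "u \<le> 1" using rs r by (auto simp: u_def field_simps)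
      have us: "u * r + (1 - u) * (1 - r) = s"
      proof -
        have "u * (1 - 2 * r) = 1 - r - s" using r by (simp add: u_def)
        then show ?thesis by (simp add: algebra_simps)
      qed
      have q: "b r \<in> {0..1}" "v r (b r) = b r" "b r \<le> r"
        using b_in[OF r(2)] b_range[OF r(2)] r by (auto simp: S_def)
      have "u * v r (b r) + (1 - u) * v (1 - r) (b r) \<le> v (u * r + (1 - u) * (1 - r)) (b r)"
        using r u by (intro concave_onD_unit[OF conc1[OF q(1)]]) auto
      then have "b r \<le> v s (b r)" using us sym[OF r(2) q(1)] q by (simp add: algebra_simps)
      moreover have "v s (b r) \<le> b r" using le[OF r(3) q(1)] by simp
      ultimately have "b r \<in> S s" using q rs by (auto simp: S_def)
      then show ?thesis by (rule S_le)
    qed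
  qed
  show "upper_semicontinuous_on {0..1} b"
    unfolding upper_semicontinuous_on_def
  proof (intro ballI allI impI)
    fix x a :: real assume x: "x \<in> {0..1}" and a: "b x < a"
    \<comment> \<open>A level strictly between \<open>b x\<close> and \<open>a\<close>, at which
      \<open>v\<close> can be tested.\<close>
    define q where "q = (b x + a) / 2"
    have q: "b x < q" "q < a" using a by (auto simp: q_def)
    have "\<exists>d>0. \<forall>y\<in>{0..1}. \<bar>y - x\<bar> < d \<longrightarrow> b y < a"
    proof (cases "q \<le> min x (1 - x)")
      \<comment> \<open>Here \<open>q\<close> lies above the triangle at \<open>x\<close>; as
        \<open>min y (1 - y)\<close> is 1-Lipschitz, the bound on \<open>b y\<close> stays below
        \<open>q\<close> nearby.\<close>
      case False
      show ?thesis
      proof (intro exI[of _ "q - min x (1 - x)"] conjI ballI impI)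
        fix y :: real assume y: "y \<in> {0..1}" "\<bar>y - x\<bar> < q - min x (1 - x)"
        have "b y \<le> min y (1 - y)" using b_range[OF y(1)] by simp
        also have "\<dots> \<le> min x (1 - x) + \<bar>y - x\<bar>" by linarith
        finally show "b y < a" using y q by linarith
      qed (use False in linarith)
    next
      case True
      have q0: "0 \<le> q" using q b_range[OF x] by linarith
      have q1: "q \<in> {0..1}" using q0 True x by auto
      have "q \<notin> S x" using S_le[of q x] q by linarith
      then have "v x q \<noteq> q" using True q0 by (simp add: S_def)
      \<comment> \<open>The gap \<open>q - v x q\<close> is the radius: within it the Lipschitz
        bound in the first argument prevents \<open>v y q = q\<close>, whereas
        \<open>b y \<ge> a > q\<close> would force this equality by \<open>down\<close>.\<close>
      then have vq: "v x q < q" using le[OF x q1] by simp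
      show ?thesis
      proof (intro exI[of _ "q - v x q"] conjI ballI impI)
        fix y :: real assume y: "y \<in> {0..1}" "\<bar>y - x\<bar> < q - v x q"
        show "b y < a"
        proof (rule ccontr)
          assume "\<not> b y < a"
          then have "q \<in> S y" using q q0 by (intro down[OF y(1) b_in[OF y(1)]]) auto
          then have "v y q = q" by (simp add: S_def)
          then show False using lip1[OF x y(1) q1] y(2) by simp
        qed
      qed (use vq in simp)
    qed
    then show "\<forall>\<^sub>F y in at x within {0..1}. b y < a"
      unfolding eventually_at by (auto simp: dist_real_def)
  qed
qed

section \<open>The boundary of the testing problem\<close>

definition pt :: "real \<Rightarrow> real \<Rightarrow> real^2" where
  "pt p q = (\<chi> i. if i = 1 then p else q)"

lemma pt_simps [simp]: "pt p q $ 1 = p" "pt p q $ 2 = q"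
  by (simp_all add: pt_def)

lemma pt_eta: "pt (\<pi> $ 1) (\<pi> $ 2) = \<pi>"
  by (simp add: vec_eq_iff forall_2)

lemma pt_in_cbox: "pt p q \<in> cbox 0 1 \<longleftrightarrow> p \<in> {0..1} \<and> q \<in> {0..1}"
  by (auto simp: mem_box_cart forall_2)

lemma terminal_cost_pt: "terminal_cost (pt p q) = min (min p (1 - p)) (min q (1 - q))"
  by (simp add: terminal_cost_def)

context testing_problem
begin

definition v :: "real \<Rightarrow> real \<Rightarrow> real" where
  "v p q = enn2real (V (pt p q))"

lemma V_pt:
  assumes "p \<in> {0..1}" "q \<in> {0..1}"
  shows "V (pt p q) = ennreal (v p q)"
proof -
  have "V (pt p q) \<le> ennreal (terminal_cost (pt p q))"
    using assms by (intro V_le_terminal_cost) (simp add: pt_in_cbox)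
  also have "\<dots> < top" by simp
  finally show ?thesis by (simp add: v_def)
qed

lemma v_le:
  assumes "p \<in> {0..1}" "q \<in> {0..1}"
  shows "v p q \<le> min (min p (1 - p)) (min q (1 - q))"
proof -
  have "ennreal (v p q) \<le> ennreal (terminal_cost (pt p q))"
    using assms unfolding V_pt[OF assms, symmetric] by (intro V_le_terminal_cost) (simp add: pt_in_cbox)
  then show ?thesis
    using assms by (subst (asm) ennreal_le_iff) (auto simp: terminal_cost_pt)
qed

lemma v_nonneg: "0 \<le> v p q"
  by (simp add: v_def)

lemma v_symmetric:
  assumes "p \<in> {0..1}" "q \<in> {0..1}"
  shows "v (1 - p) q = v p q"
proof -
  have "reflect (pt p q) = pt (1 - p) q" by (simp add: reflect_def pt_def vec_eq_iff)
  then show ?thesis using V_reflect[of "pt p q"] assms by (simp add: v_def pt_in_cbox)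
qed

lemma v_concave_step:
  assumes in1: "p \<in> {0..1}" "q \<in> {0..1}" "p' \<in> {0..1}" "q' \<in> {0..1}"
    and l: "0 \<le> l" "0 \<le> m" "l + m = 1" and eq: "p = p' \<or> q = q'"
  shows "l * v p q + m * v p' q' \<le> v (l * p + m * p') (l * q + m * q')"
\<comment> \<open>\<open>V_concave\<close> requires both weights to be positive.\<close>
proof (cases "l = 0 \<or> m = 0")
  case True
  then show ?thesis using l by auto
next
  case False
  \<comment> \<open>The coordinate along which the two points may differ.\<close>
  define i :: 2 where "i = (if p = p' then 2 else 1)"
  have m: "m = 1 - l" using l by simp
  let ?p = "l * p + m * p'" and ?q = "l * q + m * q'"
  have in2: "?p \<in> {0..1}" "?q \<in> {0..1}"
    using in1 l convexD[OF convex_real_interval(5)[of 0 1], of _ _ l m] by (auto simp del: atLeastAtMost_iff)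
  have "ennreal l * V (pt p q) + ennreal (1 - l) * V (pt p' q') \<le> V (pt ?p ?q)"
  proof (rule V_concave[where i = i])
    show "pt ?p ?q $ i = l * pt p q $ i + (1 - l) * pt p' q' $ i" by (simp add: i_def m)
    show "pt p q $ j = pt ?p ?q $ j \<and> pt p' q' $ j = pt ?p ?q $ j" if "j \<noteq> i" for j
    proof -
      consider "j = 1" | "j = 2" using exhaust_2 by blast
      then show ?thesis
        using that eq by cases (auto simp: i_def m algebra_simps split: if_splits)
    qed
  qed (use in1 in2 l False in \<open>auto simp: pt_in_cbox simp del: atLeastAtMost_iff\<close>)
  then have "ennreal (l * v p q + (1 - l) * v p' q') \<le> ennreal (v ?p ?q)"
    using l in1 in2 v_nonneg by (simp add: V_pt ennreal_mult' ennreal_plus del: atLeastAtMost_iff)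
  then show ?thesis using v_nonneg by (simp add: m)
qed

lemma stopping_boundary:
  obtains b where "\<And>p. p \<in> {0..1} \<Longrightarrow> 0 \<le> b p \<and> b p \<le> min p (1 - p)"
    "upper_semicontinuous_on {0..1} b" "mono_on {0..1/2} b" "\<And>p. p \<in> {0..1} \<Longrightarrow> b p = b (1 - p)"
    "stopping_region V \<inter> bottom_triangle = {\<pi> \<in> bottom_triangle. \<pi> $ 2 \<le> b (\<pi> $ 1)}"
proof -
  have conc1: "concave_on {0..1} (\<lambda>p. v p q)" if "q \<in> {0..1}" for q
    unfolding concave_on_iff
  proof (intro conjI ballI allI impI)
    fix x y l m :: real
    assume "x \<in> {0..1}" "y \<in> {0..1}" "0 \<le> l" "0 \<le> m" "l + m = 1"
    then show "l * v x q + m * v y q \<le> v (l *\<^sub>R x + m *\<^sub>R y) q"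
      using v_concave_step[of x q y q l m] that distrib_right[of l m q] by simp
  qed simp
  have conc2: "concave_on {0..1} (v p)" if "p \<in> {0..1}" for p
    unfolding concave_on_iff
  proof (intro conjI ballI allI impI)
    fix x y l m :: real
    assume "x \<in> {0..1}" "y \<in> {0..1}" "0 \<le> l" "0 \<le> m" "l + m = 1"
    then show "l * v p x + m * v p y \<le> v p (l *\<^sub>R x + m *\<^sub>R y)"
      using v_concave_step[of p x p y l m] that distrib_right[of l m p] by simp
  qed simp
  from biconcave_boundary[OF conc1 conc2 v_nonneg v_le v_symmetric] obtain b where b:
    "\<And>p. p \<in> {0..1} \<Longrightarrow> 0 \<le> b p \<and> b p \<le> min p (1 - p)"
    "upper_semicontinuous_on {0..1} b" "mono_on {0..1/2} b" "\<And>p. p \<in> {0..1} \<Longrightarrow> b p = b (1 - p)"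
    "\<And>p q. p \<in> {0..1} \<Longrightarrow> 0 \<le> q \<Longrightarrow> q \<le> min p (1 - p) \<Longrightarrow> v p q = q \<longleftrightarrow> q \<le> b p"
    by metis
  have "\<pi> \<in> stopping_region V \<longleftrightarrow> \<pi> $ 2 \<le> b (\<pi> $ 1)" if "\<pi> \<in> bottom_triangle" for \<pi>
  proof -
    obtain p q where \<pi>: "\<pi> = pt p q" using pt_eta by metis
    have pq: "p \<in> {0..1}" "q \<in> {0..1}" "q \<le> min p (1 - p)"
      using that by (auto simp: bottom_triangle_def \<pi> pt_in_cbox)
    \<comment> \<open>On the triangle \<open>q \<le> 1/2\<close>, so the terminal cost is the second
      coordinate.\<close>
    then have "min (min p (1 - p)) (min q (1 - q)) = q" by auto
    then have "\<pi> \<in> stopping_region V \<longleftrightarrow> ennreal (v p q) = ennreal q"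
      using pq by (simp add: stopping_region_def \<pi> pt_in_cbox terminal_cost_pt V_pt)
    also have "\<dots> \<longleftrightarrow> v p q = q" using pq v_nonneg by (intro ennreal_inj) auto
    also have "\<dots> \<longleftrightarrow> q \<le> b p" using b(5)[of p q] pq by simp
    finally show ?thesis by (simp add: \<pi>)
  qed
  then have "stopping_region V \<inter> bottom_triangle = {\<pi> \<in> bottom_triangle. \<pi> $ 2 \<le> b (\<pi> $ 1)}" by blast
  with b(1-4) show thesis by (rule that)
qed

end

theorem proposition4p3:
  fixes M :: "'a measure"
    and P :: "real^2 \<Rightarrow> 'a measure"
    and Y :: "2 \<Rightarrow> 'a \<Rightarrow> real"
    and W :: "2 \<Rightarrow> real \<Rightarrow> 'a \<Rightarrow> real"
    and Post :: "real^2 \<Rightarrow> 2 \<Rightarrow> real \<Rightarrow> 'a \<Rightarrow> real"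
    and \<mu> :: "real^2" and c :: real
    and F :: "ennreal \<Rightarrow> 'a measure"
    and V :: "real^2 \<Rightarrow> ennreal"
    and D T :: "(real^2) set"
  assumes "\<mu> $ 1 > 0" and "\<mu> $ 2 > 0" and "c > 0"
    and "testing_model M P Y W"
    and "F = observed_filtration M (observation \<mu> Y W)"
    and "\<And>\<pi>. \<pi> \<in> cbox 0 1 \<Longrightarrow> posterior_process (P \<pi>) F Y (Post \<pi>)"
    and "V = value_function P F Post c"
    and "D = stopping_region V"
    and "T = bottom_triangle"
  shows "\<exists>b :: real \<Rightarrow> real.
           (\<forall>p\<in>{0..1}. b p \<in> {0..1}) \<and>
           upper_semicontinuous_on {0..1} b \<and>
           (\<forall>p\<in>{0..1}. b p \<le> min p (1 - p)) \<and>
           D \<inter> T = {\<pi> \<in> T. \<pi> $ 2 \<le> b (\<pi> $ 1)} \<and>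
           mono_on {0..1/2} b \<and>
           (\<forall>p\<in>{0..1}. b p = b (1 - p))"
proof -
  interpret testing_problem M P Y W \<mu> Post c
  proof unfold_locales
    show "testing_model M P Y W" "c > 0" by fact+
    show "posterior_process (P \<pi>) (observed_filtration M (observation \<mu> Y W)) Y (Post \<pi>)"
      if "\<pi> \<in> cbox 0 1" for \<pi>
      using assms(6)[OF that] by (simp only: assms(5))
  qed
  note boundary = stopping_boundary[folded assms(5), folded assms(7), folded assms(8), folded assms(9)]
  show ?thesis
  proof (rule boundary)
    fix b assume b: "\<And>p. p \<in> {0..1} \<Longrightarrow> 0 \<le> b p \<and> b p \<le> min p (1 - p)"
      "upper_semicontinuous_on {0..1} b" "mono_on {0..1/2} b" "\<And>p. p \<in> {0..1} \<Longrightarrow> b p = b (1 - p)"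
      "D \<inter> T = {\<pi> \<in> T. \<pi> $ 2 \<le> b (\<pi> $ 1)}"
    have "b p \<in> {0..1}" if "p \<in> {0..1}" for p
      using b(1)[OF that] that by auto
    with b show ?thesis by blast
  qed
qed

end
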